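(* Let $F$ be a field and let $n\ge 0$ be an integer. The Hilbert series of the quadratic algebra $Q_n^!$ dual to $Q_n$ is $$H(Q_n^!,t)=\frac{1+t(2+t)^n}{1+t}.$$
   Context: Let $V$ be the $F$-vector space with basis $\{v(A): \emptyset\neq A\subseteq\{1,\dots,n\}\}$, and put $v(\emptyset)=0$. In the tensor algebra $T(V)$, for $A\subseteq\{1,\dots,n\}$ and distinct $i,j\in A$ put $$\mathcal V(A:\{i,j\})=v(A)\bigl(v(A\setminus\{i\})-v(A\setminus\{j\})\bigr)+\bigl(v(A\setminus\{i\})-v(A\setminus\{j\})\bigr)v(A\setminus\{i,j\})-v(A\setminus\{i\})^2+v(A\setminus\{j\})^2$$ (well defined up to sign). Let $\mathcal Q\subseteq V\otimes V$ be the span of all $\mathcal V(A:\{i,j\})$, $A\subseteq\{1,\dots,n\}$, $i\ne j\in A$. Then $Q_n=T(V)/\langle\mathcal Q\rangle$. Let $V^*$ be the dual space, let $\mathcal Q^\perp\subseteq V^*\otimes V^*$ be the annihilator of $\mathcal Q$ under the pairing $\langle a\otimes b,f\otimes g\rangle=f(a)g(b)$, and let $Q_n^!=T(V^* )/\langle\mathcal Q^\perp\rangle$, where $\langle\cdot\rangle$ denotes the two-sided ideal generated. $Q_n^!$ is graded with the image of $V^*$ in degree $1$. For a graded vector space $W=\sum_{i\ge 0}W_i$ with all $W_i$ finite dimensional, the Hilbert series is $H(W,t)=\sum_{i\ge0}(\dim W_i)t^i$. *)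

theory Defs
  imports
    "HOL-Library.Poly_Mapping"
    "HOL-Algebra.Embedded_Algebras"
    "HOL-Algebra.QuotRing"
    "HOL-Computational_Algebra.Formal_Power_Series"
begin

section \<open>Free algebras and quadratic algebras\<close>

text \<open>
  Lists under concatenation are the free monoid. With this instance, the ring structure of
  \<^theory>\<open>HOL-Library.Poly_Mapping\<close> makes \<open>'b list \<Rightarrow>\<^sub>0 'f\<close> the free associative
  (monoid) algebra with generators \<open>'b\<close> and coefficients \<open>'f\<close>.
\<close>

instantiation list :: (type) monoid_add
begin

definition zero_list :: "'a list" where "zero_list = []"

definition plus_list :: "'a list \<Rightarrow> 'a list \<Rightarrow> 'a list" where "plus_list xs ys = xs @ ys"

instance
  by standard (auto simp: zero_list_def plus_list_def)

end

definition pm_scale :: "'f::field \<Rightarrow> ('b \<Rightarrow>\<^sub>0 'f) \<Rightarrow> ('b \<Rightarrow>\<^sub>0 'f)" where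
  "pm_scale c p = Poly_Mapping.map ((*) c) p"

lemma lookup_pm_scale [simp]: "Poly_Mapping.lookup (pm_scale c p) x = c * Poly_Mapping.lookup p x"
  by (simp add: pm_scale_def Poly_Mapping.map.rep_eq when_def)

lemma vector_space_pm_scale: "vector_space (pm_scale :: 'f::field \<Rightarrow> ('b \<Rightarrow>\<^sub>0 'f) \<Rightarrow> _)"
  by standard (auto intro!: poly_mapping_eqI simp: lookup_add algebra_simps)

text \<open>
  The tensor algebra of a vector space with basis \<open>B\<close>: it has the words in \<open>B\<close> as a basis, the
  word \<open>[b\<^sub>1, \<dots>, b\<^sub>k]\<close> being the tensor \<open>b\<^sub>1 \<otimes> \<dots> \<otimes> b\<^sub>k\<close>, and
  concatenation of words as multiplication.
\<close>

definition tensor_algebra :: "'b set \<Rightarrow> ('b list \<Rightarrow>\<^sub>0 'f::field) ring" where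
  "tensor_algebra B =
    \<lparr>carrier = {p. Poly_Mapping.keys p \<subseteq> lists B}, monoid.mult = (*), one = 1, zero = 0, add = (+)\<rparr>"

definition tensor_power :: "'b set \<Rightarrow> nat \<Rightarrow> ('b list \<Rightarrow>\<^sub>0 'f::field) set" where
  "tensor_power B k = {p. Poly_Mapping.keys p \<subseteq> {w \<in> lists B. length w = k}}"

lemma tensor_power_subset: "tensor_power B k \<subseteq> carrier (tensor_algebra B)"
  by (auto simp: tensor_power_def tensor_algebra_def)

lemma ring_tensor_algebra: "ring (tensor_algebra B :: ('b list \<Rightarrow>\<^sub>0 'f::field) ring)"
proof -
  let ?C = "{p :: 'b list \<Rightarrow>\<^sub>0 'f. Poly_Mapping.keys p \<subseteq> lists B}"
  have add: "p + q \<in> ?C" if "p \<in> ?C" "q \<in> ?C" for p q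
    using that Poly_Mapping.keys_add[of p q] by auto
  have mult: "p * q \<in> ?C" if "p \<in> ?C" "q \<in> ?C" for p q
    using that keys_mult[of p q] by (fastforce simp: plus_list_def)
  have one: "1 \<in> ?C"
    by (auto simp: zero_list_def)
  have minus: "\<exists>q\<in>?C. q + p = 0 \<and> p + q = 0" if "p \<in> ?C" for p
    using that by (intro bexI[of _ "- p"]) auto
  show ?thesis
    by (unfold_locales)
      (use add mult one minus in \<open>auto simp: tensor_algebra_def Units_def algebra_simps\<close>)
qed

definition quadratic_algebra ::
  "'b set \<Rightarrow> ('b list \<Rightarrow>\<^sub>0 'f::field) set \<Rightarrow> ('b list \<Rightarrow>\<^sub>0 'f) set ring" where
  "quadratic_algebra B R = tensor_algebra B Quot (Idl\<^bsub>tensor_algebra B\<^esub> R)"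

definition quadratic_component ::
  "'b set \<Rightarrow> ('b list \<Rightarrow>\<^sub>0 'f::field) set \<Rightarrow> nat \<Rightarrow> ('b list \<Rightarrow>\<^sub>0 'f) set set" where
  "quadratic_component B R k =
    (\<lambda>p. (Idl\<^bsub>tensor_algebra B\<^esub> R) +>\<^bsub>tensor_algebra B\<^esub> p) ` tensor_power B k"

text \<open>The copy \<open>F \<cdot> 1\<close> of the ground field inside the quotient; \<open>single [] c\<close> is \<open>c \<cdot> 1\<close>.\<close>

definition quadratic_scalars ::
  "'b set \<Rightarrow> ('b list \<Rightarrow>\<^sub>0 'f::field) set \<Rightarrow> ('b list \<Rightarrow>\<^sub>0 'f) set set" where
  "quadratic_scalars B R =
    (\<lambda>c. (Idl\<^bsub>tensor_algebra B\<^esub> R) +>\<^bsub>tensor_algebra B\<^esub> (Poly_Mapping.single [] c)) ` UNIV"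

text \<open>
  Hilbert series of a family \<open>W\<close> of \<open>K\<close>-subspaces of a \<open>K\<close>-algebra \<open>A\<close>. The constant
  \<^const>\<open>ring.dim\<close> is only meaningful for finite-dimensional subspaces.
\<close>

definition hilbert_series :: "'a ring \<Rightarrow> 'a set \<Rightarrow> (nat \<Rightarrow> 'a set) \<Rightarrow> rat fps" where
  "hilbert_series A K W = Abs_fps (\<lambda>i. of_nat (ring.dim A K (W i)))"


section \<open>The space \<open>V\<close> and the algebra \<open>Q\<^sub>n\<close>\<close>

definition index_sets :: "nat \<Rightarrow> nat set set" where
  "index_sets n = {A. A \<noteq> {} \<and> A \<subseteq> {1..n}}"

definition V_space :: "nat \<Rightarrow> (nat set \<Rightarrow>\<^sub>0 'f::field) set" where
  "V_space n = {x. Poly_Mapping.keys x \<subseteq> index_sets n}"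

definition basis_vec :: "nat set \<Rightarrow> (nat set \<Rightarrow>\<^sub>0 'f::field)" where
  "basis_vec A = (if A = {} then 0 else Poly_Mapping.single A 1)"

definition V_basis :: "nat \<Rightarrow> (nat set \<Rightarrow>\<^sub>0 'f::field) set" where
  "V_basis n = basis_vec ` index_sets n"

text \<open>\<open>v(A)\<close> as an element of the tensor algebra.\<close>

definition tv :: "nat set \<Rightarrow> ((nat set \<Rightarrow>\<^sub>0 'f) list \<Rightarrow>\<^sub>0 'f::field)" where
  "tv A = (if A = {} then 0 else Poly_Mapping.single [basis_vec A] 1)"

definition Q_rel :: "nat set \<Rightarrow> nat \<Rightarrow> nat \<Rightarrow> ((nat set \<Rightarrow>\<^sub>0 'f) list \<Rightarrow>\<^sub>0 'f::field)" where
  "Q_rel A i j =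
    tv A * (tv (A - {i}) - tv (A - {j})) + (tv (A - {i}) - tv (A - {j})) * tv (A - {i, j})
    - (tv (A - {i}))\<^sup>2 + (tv (A - {j}))\<^sup>2"

definition Q_space :: "nat \<Rightarrow> ((nat set \<Rightarrow>\<^sub>0 'f) list \<Rightarrow>\<^sub>0 'f::field) set" where
  "Q_space n = module.span pm_scale {Q_rel A i j | A i j. A \<subseteq> {1..n} \<and> i \<in> A \<and> j \<in> A \<and> i \<noteq> j}"

definition Q_algebra :: "nat \<Rightarrow> ((nat set \<Rightarrow>\<^sub>0 'f) list \<Rightarrow>\<^sub>0 'f::field) set ring" where
  "Q_algebra n = quadratic_algebra (V_basis n) (Q_space n)"


section \<open>The dual space and the algebra \<open>Q\<^sub>n\<^sup>!\<close>\<close>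

text \<open>
  Functionals on \<open>V\<close> are functions on the surrounding type, normalised to be \<open>0\<close> off \<open>V\<close> so
  that two functionals are equal iff they agree on \<open>V\<close>.
\<close>

definition dual_space :: "nat \<Rightarrow> ((nat set \<Rightarrow>\<^sub>0 'f::field) \<Rightarrow> 'f) set" where
  "dual_space n = {f.
    (\<forall>x\<in>V_space n. \<forall>y\<in>V_space n. f (x + y) = f x + f y) \<and>
    (\<forall>c. \<forall>x\<in>V_space n. f (pm_scale c x) = c * f x) \<and>
    (\<forall>x. x \<notin> V_space n \<longrightarrow> f x = 0)}"

definition dual_vec :: "nat \<Rightarrow> nat set \<Rightarrow> (nat set \<Rightarrow>\<^sub>0 'f::field) \<Rightarrow> 'f" where
  "dual_vec n A = (\<lambda>x. if x \<in> V_space n then Poly_Mapping.lookup x A else 0)"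

definition dual_basis :: "nat \<Rightarrow> ((nat set \<Rightarrow>\<^sub>0 'f::field) \<Rightarrow> 'f) set" where
  "dual_basis n = dual_vec n ` index_sets n"

lemma finite_index_sets: "finite (index_sets n)"
  by (rule finite_subset[of _ "Pow {1..n}"]) (auto simp: index_sets_def)

lemma basis_vec_in_V_space: "A \<in> index_sets n \<Longrightarrow> basis_vec A \<in> V_space n"
  by (auto simp: basis_vec_def V_space_def)

lemma dual_vec_basis_vec:
  "A \<in> index_sets n \<Longrightarrow> B \<in> index_sets n \<Longrightarrow> dual_vec n A (basis_vec B) = (if A = B then 1 else 0)"
  using basis_vec_in_V_space[of B n]
  by (auto simp: dual_vec_def basis_vec_def index_sets_def lookup_single when_def)

lemma dual_vec_in_dual_space: "A \<in> index_sets n \<Longrightarrow> dual_vec n A \<in> dual_space n"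
proof -
  have "x + y \<in> V_space n" if "x \<in> V_space n" "y \<in> V_space n" for x y :: "nat set \<Rightarrow>\<^sub>0 'a"
    using that Poly_Mapping.keys_add[of x y] by (auto simp: V_space_def)
  moreover have "pm_scale c x \<in> V_space n" if "x \<in> V_space n" for c and x :: "nat set \<Rightarrow>\<^sub>0 'a"
    using that by (auto simp: V_space_def in_keys_iff)
  ultimately show ?thesis
    by (auto simp: dual_space_def dual_vec_def lookup_add)
qed

lemma V_space_expansion:
  assumes "x \<in> V_space n"
  shows "x = (\<Sum>A\<in>index_sets n. pm_scale (Poly_Mapping.lookup x A) (basis_vec A))"
proof (rule poly_mapping_eqI)
  fix B
  have "Poly_Mapping.lookup (\<Sum>A\<in>index_sets n. pm_scale (Poly_Mapping.lookup x A) (basis_vec A)) B =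
      (\<Sum>A\<in>index_sets n. if A = B then Poly_Mapping.lookup x A else 0)"
    unfolding lookup_sum
    by (rule sum.cong) (auto simp: basis_vec_def index_sets_def lookup_single when_def)
  also have "\<dots> = Poly_Mapping.lookup x B"
    using assms finite_index_sets[of n] by (auto simp: sum.delta V_space_def in_keys_iff)
  finally show "Poly_Mapping.lookup x B =
      Poly_Mapping.lookup (\<Sum>A\<in>index_sets n. pm_scale (Poly_Mapping.lookup x A) (basis_vec A)) B" ..
qed

text \<open>
  Together with \<open>dual_vec_basis_vec\<close> and \<open>dual_vec_in_dual_space\<close>, this shows that \<open>dual_basis n\<close>
  is a basis of the space of all functionals.
\<close>

lemma dual_space_expansion:
  assumes f: "f \<in> dual_space n"
  shows "f = (\<lambda>x. \<Sum>A\<in>index_sets n. f (basis_vec A) * dual_vec n A x)"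
proof
  fix x
  show "f x = (\<Sum>A\<in>index_sets n. f (basis_vec A) * dual_vec n A x)"
  proof (cases "x \<in> V_space n")
    case False
    then show ?thesis using f by (simp add: dual_space_def dual_vec_def)
  next
    case x: True
    have sc: "pm_scale c y \<in> V_space n" if "y \<in> V_space n" for c y
      using that by (auto simp: V_space_def in_keys_iff)
    have ad: "y + z \<in> V_space n" if "y \<in> V_space n" "z \<in> V_space n" for y z :: "nat set \<Rightarrow>\<^sub>0 'a"
      using that Poly_Mapping.keys_add[of y z] by (auto simp: V_space_def)
    have f0: "f 0 = 0"
    proof -
      have "0 \<in> V_space n" by (simp add: V_space_def)
      then have "f (0 + 0) = f 0 + f 0" using f unfolding dual_space_def by blast
      then show ?thesis by (metis add_cancel_right_right add.right_neutral)
    qed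
    have "(\<Sum>A\<in>I. pm_scale (c A) (basis_vec A)) \<in> V_space n \<and>
        f (\<Sum>A\<in>I. pm_scale (c A) (basis_vec A)) = (\<Sum>A\<in>I. c A * f (basis_vec A))"
      if "finite I" "I \<subseteq> index_sets n" for I c
      using that
    proof (induction I rule: finite_induct)
      case empty
      show ?case by (simp add: f0) (simp add: V_space_def)
    next
      case (insert A I)
      let ?s = "\<Sum>A\<in>I. pm_scale (c A) (basis_vec A)"
      have s: "?s \<in> V_space n" "f ?s = (\<Sum>A\<in>I. c A * f (basis_vec A))"
        using insert by auto
      have vA: "basis_vec A \<in> V_space n" using insert.prems by (auto intro: basis_vec_in_V_space)
      have "f (pm_scale (c A) (basis_vec A) + ?s) = f (pm_scale (c A) (basis_vec A)) + f ?s"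
        using f s(1) sc[OF vA] unfolding dual_space_def by blast
      moreover have "f (pm_scale (c A) (basis_vec A)) = c A * f (basis_vec A)"
        using f vA by (auto simp: dual_space_def)
      ultimately show ?case
        using insert.hyps s ad[OF sc[OF vA] s(1)] by simp
    qed
    from this[OF finite_index_sets subset_refl, of "Poly_Mapping.lookup x"]
    have "f x = (\<Sum>A\<in>index_sets n. Poly_Mapping.lookup x A * f (basis_vec A))"
      using V_space_expansion[OF x] by simp
    then show ?thesis using x by (simp add: dual_vec_def mult.commute)
  qed
qed

text \<open>The bilinear extension of \<open>\<langle>a \<otimes> b, f \<otimes> g\<rangle> = f(a) g(b)\<close> from words of length 2.\<close>

fun word_pairing :: "'a list \<Rightarrow> ('a \<Rightarrow> 'f::field) list \<Rightarrow> 'f" where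
  "word_pairing [a, b] [f, g] = f a * g b"
| "word_pairing _ _ = 0"

definition tensor_pairing :: "('a list \<Rightarrow>\<^sub>0 'f::field) \<Rightarrow> (('a \<Rightarrow> 'f) list \<Rightarrow>\<^sub>0 'f) \<Rightarrow> 'f" where
  "tensor_pairing q r = (\<Sum>x\<in>Poly_Mapping.keys q. \<Sum>y\<in>Poly_Mapping.keys r.
    Poly_Mapping.lookup q x * Poly_Mapping.lookup r y * word_pairing x y)"

definition Q_perp :: "nat \<Rightarrow> (((nat set \<Rightarrow>\<^sub>0 'f) \<Rightarrow> 'f) list \<Rightarrow>\<^sub>0 'f::field) set" where
  "Q_perp n = {r \<in> tensor_power (dual_basis n) 2. \<forall>q\<in>Q_space n. tensor_pairing q r = 0}"

type_synonym 'f dual_tensor = "((nat set \<Rightarrow>\<^sub>0 'f) \<Rightarrow> 'f) list \<Rightarrow>\<^sub>0 'f"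

definition Q_dual :: "nat \<Rightarrow> 'f::field dual_tensor set ring" where
  "Q_dual n = quadratic_algebra (dual_basis n) (Q_perp n)"

definition Q_dual_component :: "nat \<Rightarrow> nat \<Rightarrow> 'f::field dual_tensor set set" where
  "Q_dual_component n = quadratic_component (dual_basis n) (Q_perp n)"

definition Q_dual_scalars :: "nat \<Rightarrow> 'f::field dual_tensor set set" where
  "Q_dual_scalars n = quadratic_scalars (dual_basis n) (Q_perp n)"

end

theory Submission
  imports Defs
begin

text \<open>
  Write \<open>s(A)\<close> for the basis of \<open>V\<^sup>*\<close> dual to \<open>v(A)\<close> and \<open>\<sigma>\<close> for the sum of all \<open>s(A)\<close>. The relations of
  \<open>Q\<^sub>n\<^sup>!\<close> include \<open>s(A)s(B) = 0\<close> unless \<open>B = A\<close> or \<open>B = A \<setminus> {i}\<close>, together with \<open>\<sigma> s(A) = 0\<close>, and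
  \<open>s(A) \<sigma> = 0\<close> for \<open>\<bar>A\<bar> \<ge> 2\<close>. For disjoint \<open>C \<noteq> {}\<close> and \<open>D\<close>, let \<open>E(C, D)\<close> be the product of \<open>s\<close> along the chain that
  descends from \<open>C \<union> D\<close> to \<open>C\<close> by removing the elements of \<open>D\<close> in decreasing order. These relations make removal
  orders anticommute, so the \<open>E(C, D)\<close> span, and they give the linear relations
  \<open>\<Sum>\<^sub>i \<plusminus>E(C \<setminus> {i}, D \<union> {i}) = \<Sum>\<^sub>l \<plusminus>E(C, D \<union> {l})\<close> for \<open>\<bar>C\<bar> \<ge> 2\<close>, with \<open>i\<close> in \<open>C\<close> and \<open>l\<close> outside \<open>C \<union> D\<close>.
  They eliminate every \<open>E(C, D)\<close> with \<open>max (C \<union> D) \<in> D\<close>.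

  The remaining words are independent: a function \<open>g\<close> of \<open>(C, D)\<close> that respects the linear relations extends to a
  functional that kills the ideal, because left multiplication by \<open>s(B)\<close> has an adjoint \<open>[d, P\<^sub>B]\<close> on such functions,
  where \<open>d\<close> inserts an element into \<open>D\<close> and \<open>P\<^sub>B\<close> restricts to \<open>C \<union> D = B\<close>. Sufficiently many \<open>g\<close> are given explicitly.
  With the maximum \<open>m + 1\<close> in \<open>C\<close>, every smaller element lies in \<open>C\<close>, in \<open>D\<close> or in neither, so the Hilbert series
  is \<open>1 + t \<Sum>\<^sub>m\<^sub><\<^sub>n (2 + t)\<^sup>m\<close>.
\<close>

section \<open>Word functionals and dimensions of graded components\<close>

lemma poly_mapping_sum_keys:
  fixes p :: "'b \<Rightarrow>\<^sub>0 'f::comm_monoid_add"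
  shows "p = (\<Sum>w\<in>Poly_Mapping.keys p. Poly_Mapping.single w (Poly_Mapping.lookup p w))"
proof (rule poly_mapping_eqI)
  fix k
  show "Poly_Mapping.lookup p k = Poly_Mapping.lookup
      (\<Sum>w\<in>Poly_Mapping.keys p. Poly_Mapping.single w (Poly_Mapping.lookup p w)) k"
    by (simp add: lookup_sum lookup_single when_def sum.delta in_keys_iff)
qed

text \<open>The linear functional on the free algebra with the value \<open>f w\<close> at each word
  \<open>w\<close>. Functionals that vanish on an ideal detect elements outside it; this is how
  independence in the quotient is proved.\<close>

definition word_eval :: "('b \<Rightarrow> 'f::field) \<Rightarrow> ('b \<Rightarrow>\<^sub>0 'f) \<Rightarrow> 'f" where
  "word_eval f p = (\<Sum>w\<in>Poly_Mapping.keys p. Poly_Mapping.lookup p w * f w)"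

lemma word_eval_superset:
  "finite S \<Longrightarrow> Poly_Mapping.keys p \<subseteq> S \<Longrightarrow> word_eval f p = (\<Sum>w\<in>S. Poly_Mapping.lookup p w * f w)"
  unfolding word_eval_def by (rule sum.mono_neutral_left) (auto simp: in_keys_iff)

lemma word_eval_add: "word_eval f (p + q) = word_eval f p + word_eval f q"
proof -
  let ?S = "Poly_Mapping.keys p \<union> Poly_Mapping.keys q"
  have "word_eval f (p + q) = (\<Sum>w\<in>?S. Poly_Mapping.lookup (p + q) w * f w)"
    by (rule word_eval_superset) (auto simp: Poly_Mapping.keys_add)
  also have "\<dots> = (\<Sum>w\<in>?S. Poly_Mapping.lookup p w * f w) + (\<Sum>w\<in>?S. Poly_Mapping.lookup q w * f w)"
    by (simp add: lookup_add algebra_simps sum.distrib)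
  also have "\<dots> = word_eval f p + word_eval f q"
    by (simp add: word_eval_superset[of ?S])
  finally show ?thesis .
qed

lemma word_eval_0 [simp]: "word_eval f 0 = 0"
  by (simp add: word_eval_def)

lemma word_eval_uminus: "word_eval f (- p) = - word_eval f p"
  using word_eval_add[of f p "- p"] by (simp add: eq_neg_iff_add_eq_0 add.commute)

lemma word_eval_sum: "word_eval f (\<Sum>x\<in>X. p x) = (\<Sum>x\<in>X. word_eval f (p x))"
  by (induction X rule: infinite_finite_induct) (auto simp: word_eval_add)

lemma word_eval_single [simp]: "word_eval f (Poly_Mapping.single w c) = c * f w"
  by (simp add: word_eval_def)

lemma word_eval_pm_scale: "word_eval f (pm_scale c p) = c * word_eval f p"
proof -
  have "word_eval f (pm_scale c p) = (\<Sum>w\<in>Poly_Mapping.keys p. Poly_Mapping.lookup (pm_scale c p) w * f w)"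
    by (rule word_eval_superset) (auto simp: in_keys_iff)
  then show ?thesis by (simp add: word_eval_def sum_distrib_left algebra_simps)
qed

lemma pm_scale_single [simp]: "pm_scale c (Poly_Mapping.single w d) = Poly_Mapping.single w (c * d)"
  by (rule poly_mapping_eqI) (simp add: lookup_single when_def)

text \<open>Scaling is multiplication by a constant of the algebra, so ideals are subspaces, and the
  scalars of the quotient act as expected.\<close>

lemma pm_scale_conv_times: "pm_scale c p = Poly_Mapping.single [] c * p"
proof -
  have "Poly_Mapping.single [] c * p =
      (\<Sum>w\<in>Poly_Mapping.keys p. Poly_Mapping.single [] c * Poly_Mapping.single w (Poly_Mapping.lookup p w))"
    by (subst poly_mapping_sum_keys[of p]) (simp add: sum_distrib_left)
  also have "\<dots> = (\<Sum>w\<in>Poly_Mapping.keys p. pm_scale c (Poly_Mapping.single w (Poly_Mapping.lookup p w)))"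
    by (simp add: mult_single plus_list_def)
  also have "\<dots> = pm_scale c (\<Sum>w\<in>Poly_Mapping.keys p. Poly_Mapping.single w (Poly_Mapping.lookup p w))"
    by (rule poly_mapping_eqI) (auto simp: lookup_sum sum_distrib_left lookup_single when_def intro!: sum.cong)
  finally show ?thesis using poly_mapping_sum_keys[of p] by simp
qed

lemma word_eval_times_left:
  "word_eval f (p * q) =
    (\<Sum>x\<in>Poly_Mapping.keys p. Poly_Mapping.lookup p x * word_eval (\<lambda>w. f (x @ w)) q)"
proof -
  have "p * q = (\<Sum>x\<in>Poly_Mapping.keys p. \<Sum>y\<in>Poly_Mapping.keys q.
      Poly_Mapping.single (x @ y) (Poly_Mapping.lookup p x * Poly_Mapping.lookup q y))"
    by (subst poly_mapping_sum_keys[of p], subst poly_mapping_sum_keys[of q])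
      (simp add: sum_product mult_single plus_list_def)
  then have "word_eval f (p * q) = (\<Sum>x\<in>Poly_Mapping.keys p. \<Sum>y\<in>Poly_Mapping.keys q.
      Poly_Mapping.lookup p x * Poly_Mapping.lookup q y * f (x @ y))"
    by (simp add: word_eval_sum)
  then show ?thesis by (simp add: word_eval_def[where p = q] sum_distrib_left mult.assoc)
qed

lemma word_eval_times_right:
  "word_eval f (p * q) =
    (\<Sum>y\<in>Poly_Mapping.keys q. Poly_Mapping.lookup q y * word_eval (\<lambda>w. f (w @ y)) p)"
  by (subst word_eval_times_left, unfold word_eval_def sum_distrib_left, subst sum.swap)
    (simp add: algebra_simps)

text \<open>The elements whose translates \<open>u * p * v\<close> by words are all killed by
  \<open>f\<close> form a two-sided ideal. The translates are built into the set \<open>?J\<close>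
  to make it closed under multiplication on both sides; \<open>u = v = []\<close> gives the
  claim.\<close>

lemma word_eval_Idl:
  fixes R :: "('b list \<Rightarrow>\<^sub>0 'f::field) set"
  assumes R: "R \<subseteq> carrier (tensor_algebra B)"
    and f: "\<And>r u v. r \<in> R \<Longrightarrow> u \<in> lists B \<Longrightarrow> v \<in> lists B \<Longrightarrow> word_eval (\<lambda>w. f (u @ w @ v)) r = 0"
    and p: "p \<in> Idl\<^bsub>tensor_algebra B\<^esub> R"
  shows "word_eval f p = 0"
proof -
  let ?T = "tensor_algebra B :: ('b list \<Rightarrow>\<^sub>0 'f) ring"
  let ?J = "{p \<in> carrier ?T. \<forall>u\<in>lists B. \<forall>v\<in>lists B. word_eval (\<lambda>w. f (u @ w @ v)) p = 0}"
  interpret T: ring ?T by (rule ring_tensor_algebra)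
  have car: "carrier ?T = {p. Poly_Mapping.keys p \<subseteq> lists B}"
    and ops: "monoid.mult ?T = (*)" "add ?T = (+)" "zero ?T = 0"
    by (auto simp: tensor_algebra_def)
  have neg: "\<ominus>\<^bsub>?T\<^esub> a = - a" if "a \<in> carrier ?T" for a
  proof (rule T.minus_equality)
    show "- a \<oplus>\<^bsub>?T\<^esub> a = \<zero>\<^bsub>?T\<^esub>" by (simp add: ops)
  qed (use that in \<open>auto simp: car\<close>)
  have "ideal ?J ?T"
  proof (rule idealI)
    show "ring ?T" by (rule ring_tensor_algebra)
    show "subgroup ?J (add_monoid ?T)"
    proof (rule group.subgroupI)
      show "group (add_monoid ?T)" by (rule T.a_group)
      show "?J \<noteq> {}" by (auto simp: car intro!: exI[of _ 0])
      fix a assume a: "a \<in> ?J"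
      show "inv\<^bsub>add_monoid ?T\<^esub> a \<in> ?J"
        using a neg[of a] unfolding a_inv_def by (auto simp: car word_eval_uminus)
      fix b assume "b \<in> ?J"
      with a show "a \<otimes>\<^bsub>add_monoid ?T\<^esub> b \<in> ?J"
        using T.a_closed[of a b] by (auto simp: ops word_eval_add)
    qed auto
    fix a x assume a: "a \<in> ?J" and x: "x \<in> carrier ?T"
    have keys: "y \<in> lists B" if "y \<in> Poly_Mapping.keys x" for y using that x by (auto simp: car)
    have "word_eval (\<lambda>w. f (u @ w @ v)) (x * a) = 0" if u: "u \<in> lists B" and v: "v \<in> lists B" for u v
      unfolding word_eval_times_left
    proof (rule sum.neutral, rule ballI)
      fix y assume "y \<in> Poly_Mapping.keys x"
      then have "u @ y \<in> lists B" using keys u by auto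
      then have "word_eval (\<lambda>w. f ((u @ y) @ w @ v)) a = 0" using a v by blast
      then show "Poly_Mapping.lookup x y * word_eval (\<lambda>w. f (u @ (y @ w) @ v)) a = 0" by simp
    qed
    then show "x \<otimes>\<^bsub>?T\<^esub> a \<in> ?J" using T.m_closed[OF x, of a] a by (auto simp: ops)
    have "word_eval (\<lambda>w. f (u @ w @ v)) (a * x) = 0" if u: "u \<in> lists B" and v: "v \<in> lists B" for u v
      unfolding word_eval_times_right
    proof (rule sum.neutral, rule ballI)
      fix y assume "y \<in> Poly_Mapping.keys x"
      then have "y @ v \<in> lists B" using keys v by auto
      then have "word_eval (\<lambda>w. f (u @ w @ (y @ v))) a = 0" using a u by blast
      then show "Poly_Mapping.lookup x y * word_eval (\<lambda>w. f (u @ (w @ y) @ v)) a = 0" by simp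
    qed
    then show "a \<otimes>\<^bsub>?T\<^esub> x \<in> ?J" using T.m_closed[of a x] x a by (auto simp: ops)
  qed
  moreover have "R \<subseteq> ?J" using R f by blast
  ultimately have "Idl\<^bsub>?T\<^esub> R \<subseteq> ?J" by (rule T.genideal_minimal)
  then have "\<forall>u\<in>lists B. \<forall>v\<in>lists B. word_eval (\<lambda>w. f (u @ w @ v)) p = 0" using p by blast
  from this[rule_format, of "[]" "[]"] show ?thesis by simp
qed

text \<open>Reduces a dimension in the quotient to two statements in the free algebra: the family
  \<open>e\<close> spans degree \<open>k\<close> modulo the ideal, and it is independent modulo the
  ideal.\<close>

lemma quadratic_component_dimension:
  fixes B :: "'b set" and R :: "('b list \<Rightarrow>\<^sub>0 'f::field) set" and e :: "'i \<Rightarrow> 'b list \<Rightarrow>\<^sub>0 'f"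
  defines "T \<equiv> tensor_algebra B :: ('b list \<Rightarrow>\<^sub>0 'f) ring"
  assumes R: "R \<subseteq> carrier T"
    and one: "1 \<notin> Idl\<^bsub>T\<^esub> R"
    and X: "finite X" "\<And>x. x \<in> X \<Longrightarrow> e x \<in> tensor_power B k"
    and span: "\<And>p. p \<in> tensor_power B k \<Longrightarrow> \<exists>c. p - (\<Sum>x\<in>X. pm_scale (c x) (e x)) \<in> Idl\<^bsub>T\<^esub> R"
    and indep: "\<And>c x. (\<Sum>x\<in>X. pm_scale (c x) (e x)) \<in> Idl\<^bsub>T\<^esub> R \<Longrightarrow> x \<in> X \<Longrightarrow> c x = 0"
  shows "ring.finite_dimension (quadratic_algebra B R) (quadratic_scalars B R) (quadratic_component B R k)"
    and "ring.dim (quadratic_algebra B R) (quadratic_scalars B R) (quadratic_component B R k) = card X"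
proof -
  define I where "I = Idl\<^bsub>T\<^esub> R"
  define Q where "Q = quadratic_algebra B R"
  define h where "h = (+>\<^bsub>T\<^esub>) I"
  define K where "K = quadratic_scalars B R"
  interpret T: ring T unfolding T_def by (rule ring_tensor_algebra)
  have I: "ideal I T" unfolding I_def using R by (rule T.genideal_ideal)
  interpret I: ideal I T by (rule I)
  have Q: "Q = T Quot I" by (simp add: Q_def quadratic_algebra_def I_def T_def)
  interpret h: ring_hom_ring T Q h unfolding Q h_def by (rule I.rcos_ring_hom_ring)
  have car: "carrier T = {p. Poly_Mapping.keys p \<subseteq> lists B}"
    and ops: "monoid.mult T = (*)" "add T = (+)" "zero T = 0" "one T = 1"
    by (auto simp: tensor_algebra_def T_def)
  have neg: "\<ominus>\<^bsub>T\<^esub> a = - a" if "a \<in> carrier T" for a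
  proof (rule T.minus_equality)
    show "- a \<oplus>\<^bsub>T\<^esub> a = \<zero>\<^bsub>T\<^esub>" by (simp add: ops)
  qed (use that in \<open>auto simp: car\<close>)
  have diff: "a \<ominus>\<^bsub>T\<^esub> b = a - b" if "b \<in> carrier T" for a b
    using neg[OF that] by (simp add: a_minus_def ops)
  have eq: "h a = h b \<longleftrightarrow> a - b \<in> I" if "a \<in> carrier T" "b \<in> carrier T" for a b
    using T.quotient_eq_iff_same_a_r_cos[OF I that] diff[OF that(2), of a] by (simp add: h_def)
  let ?S = "range (\<lambda>c. Poly_Mapping.single [] c) :: ('b list \<Rightarrow>\<^sub>0 'f) set"
  have Ssub: "?S \<subseteq> carrier T" by (auto simp: car split: if_splits)
  have K: "K = h ` ?S"
    by (simp add: K_def quadratic_scalars_def h_def I_def T_def image_image)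
  have "subfield ?S T"
  proof (rule T.subfieldI)
    have m1: "Poly_Mapping.single [] a * Poly_Mapping.single [] b = Poly_Mapping.single [] (a * b)"
      for a b :: 'f by (simp add: mult_single plus_list_def)
    have one': "(1 :: 'b list \<Rightarrow>\<^sub>0 'f) = Poly_Mapping.single [] 1"
      by (simp add: zero_list_def flip: single_one)
    show "subcring ?S T"
    proof (rule T.subcringI)
      show "subring ?S T"
      proof (rule T.subringI)
        show "\<ominus>\<^bsub>T\<^esub> a \<in> ?S" if "a \<in> ?S" for a
          using that Ssub neg[of a] by (auto simp flip: single_uminus)
      qed (use Ssub m1 one' in \<open>auto simp: ops simp flip: single_add\<close>)
    qed (auto simp: ops m1 mult.commute)
    show "Units (T\<lparr>carrier := ?S\<rparr>) = ?S - {\<zero>\<^bsub>T\<^esub>}"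
    proof (intro Set.set_eqI iffI)
      fix a assume "a \<in> Units (T\<lparr>carrier := ?S\<rparr>)"
      then show "a \<in> ?S - {\<zero>\<^bsub>T\<^esub>}" by (auto simp: Units_def ops)
    next
      fix a assume "a \<in> ?S - {\<zero>\<^bsub>T\<^esub>}"
      then obtain c where c: "a = Poly_Mapping.single [] c" "c \<noteq> 0"
        using single_zero by (auto simp: ops) (metis single_zero)
      then show "a \<in> Units (T\<lparr>carrier := ?S\<rparr>)"
        unfolding Units_def by (auto simp: ops m1 one' intro!: exI[of _ "inverse c"])
    qed
  qed
  \<comment> \<open>Properness of the ideal enters here: the image of a subfield is again a subfield
    when the target ring is nonzero.\<close>
  moreover have "one Q \<noteq> zero Q"
    using eq[of 1 0] one h.hom_one h.hom_zero T.one_closed T.zero_closed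
    by (auto simp: ops I_def)
  ultimately have Ksub: "subfield K Q" unfolding K by (rule h.img_is_subfield(2))
  have E: "e x \<in> carrier T" if "x \<in> X" for x
    using X(2)[OF that] tensor_power_subset[of B k] by (auto simp: T_def)
  have sc: "pm_scale c p \<in> carrier T" if "p \<in> carrier T" for c p
    using that by (auto simp: car in_keys_iff)
  have sumc: "(\<Sum>x\<in>Y. pm_scale (c x) (e x)) \<in> carrier T" if "Y \<subseteq> X" for c Y
  proof -
    have "finite Y" using that X(1) finite_subset by blast
    then show ?thesis using that
    proof (induction Y rule: finite_induct)
      case (insert y Y)
      have "pm_scale (c y) (e y) \<oplus>\<^bsub>T\<^esub> (\<Sum>x\<in>Y. pm_scale (c x) (e x)) \<in> carrier T"
        by (rule T.a_closed) (use insert sc E in auto)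
      then show ?case using insert by (simp add: ops)
    qed (simp add: car)
  qed
  let ?W = "\<lambda>Y. range (\<lambda>c. h (\<Sum>x\<in>Y. pm_scale (c x) (e x)))"
  \<comment> \<open>The predicate \<open>dimension\<close> grows by one with each line extension by
    a vector outside the current space, so the elements of \<open>X\<close> are adjoined one at a
    time.\<close>
  have "h.S.dimension (card Y) K (?W Y)" if "Y \<subseteq> X" for Y
  proof -
    have "finite Y" using that X(1) finite_subset by blast
    then show ?thesis using that
    proof (induction Y rule: finite_induct)
      case empty
      have "h 0 = zero Q" using h.hom_zero by (simp add: ops)
      then show ?case by simp
    next
      case (insert y Y)
      have y: "e y \<in> carrier T" "y \<in> X" using insert E by auto
      have hy: "h (e y) \<notin> ?W Y"
      proof
        assume "h (e y) \<in> ?W Y"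
        then obtain c where "h (e y) = h (\<Sum>x\<in>Y. pm_scale (c x) (e x))" by auto
        then have d: "e y - (\<Sum>x\<in>Y. pm_scale (c x) (e x)) \<in> I"
          using eq y sumc[of Y c] insert by simp
        \<comment> \<open>The dependency is extended by zero from \<open>insert y Y\<close> to all
          of \<open>X\<close>; its coefficient \<open>1\<close> at \<open>y\<close> contradicts
          \<open>indep\<close>.\<close>
        let ?c = "\<lambda>x. if x = y then 1 else if x \<in> Y then - c x else 0"
        have "(\<Sum>x\<in>X. pm_scale (?c x) (e x)) = (\<Sum>x\<in>insert y Y. pm_scale (?c x) (e x))"
          by (rule sum.mono_neutral_right)
            (use X(1) insert in \<open>auto intro!: poly_mapping_eqI\<close>)
        also have "\<dots> = pm_scale 1 (e y) + (\<Sum>x\<in>Y. pm_scale (?c x) (e x))"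
          using insert by simp
        also have "(\<Sum>x\<in>Y. pm_scale (?c x) (e x)) = (\<Sum>x\<in>Y. - pm_scale (c x) (e x))"
          using insert.hyps by (intro sum.cong) (auto intro!: poly_mapping_eqI)
        also have "pm_scale 1 (e y) = e y" by (auto intro!: poly_mapping_eqI)
        also have "e y + (\<Sum>x\<in>Y. - pm_scale (c x) (e x)) = e y - (\<Sum>x\<in>Y. pm_scale (c x) (e x))"
          by (simp add: sum_negf)
        finally have "(\<Sum>x\<in>X. pm_scale (?c x) (e x)) \<in> I" using d by simp
        from indep[OF this[unfolded I_def] y(2)] show False by simp
      qed
      have "?W (insert y Y) = h.S.line_extension K (h (e y)) (?W Y)"
      proof -
        have step: "h (pm_scale a (e y) + (\<Sum>x\<in>Y. pm_scale (c x) (e x))) =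
            h (Poly_Mapping.single [] a) \<otimes>\<^bsub>Q\<^esub> h (e y) \<oplus>\<^bsub>Q\<^esub> h (\<Sum>x\<in>Y. pm_scale (c x) (e x))" for a c
        proof -
          have a: "Poly_Mapping.single [] a \<in> carrier T" by (simp add: car)
          have "h (pm_scale a (e y) \<oplus>\<^bsub>T\<^esub> (\<Sum>x\<in>Y. pm_scale (c x) (e x))) =
            h (pm_scale a (e y)) \<oplus>\<^bsub>Q\<^esub> h (\<Sum>x\<in>Y. pm_scale (c x) (e x))"
            by (rule h.hom_add) (use sc y sumc insert in auto)
          moreover have "h (pm_scale a (e y)) = h (Poly_Mapping.single [] a \<otimes>\<^bsub>T\<^esub> e y)"
            by (simp add: pm_scale_conv_times ops)
          ultimately show ?thesis using h.hom_mult[OF a y(1)] by (simp add: ops)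
        qed
        show ?thesis
        proof (intro Set.set_eqI iffI)
          fix u assume "u \<in> ?W (insert y Y)"
          then obtain c where "u = h (pm_scale (c y) (e y) + (\<Sum>x\<in>Y. pm_scale (c x) (e x)))"
            using insert.hyps by auto
          then show "u \<in> h.S.line_extension K (h (e y)) (?W Y)"
            unfolding h.S.line_extension_mem_iff K using step by blast
        next
          fix u assume "u \<in> h.S.line_extension K (h (e y)) (?W Y)"
          then obtain a c where u: "u = h (pm_scale a (e y) + (\<Sum>x\<in>Y. pm_scale (c x) (e x)))"
            unfolding h.S.line_extension_mem_iff K using step by auto
          have "(\<Sum>x\<in>Y. pm_scale (c x) (e x)) = (\<Sum>x\<in>Y. pm_scale ((c(y := a)) x) (e x))"
            using insert.hyps by (intro sum.cong) auto
          then have "u = h (\<Sum>x\<in>insert y Y. pm_scale ((c(y := a)) x) (e x))"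
            using insert.hyps u by simp
          then show "u \<in> ?W (insert y Y)" by blast
        qed
      qed
      then show ?case
        using h.S.dimension.Suc_dim[OF h.hom_closed[OF y(1)] hy insert.IH] insert by simp
    qed
  qed
  from this[of X] have "h.S.dimension (card X) K (?W X)" by simp
  moreover have "quadratic_component B R k = ?W X"
  proof (intro Set.set_eqI iffI)
    fix u assume "u \<in> quadratic_component B R k"
    then obtain p where p: "p \<in> tensor_power B k" "u = h p"
      by (auto simp: quadratic_component_def h_def I_def T_def)
    from span[OF p(1)] obtain c where "p - (\<Sum>x\<in>X. pm_scale (c x) (e x)) \<in> I"
      by (auto simp: I_def)
    then have "h p = h (\<Sum>x\<in>X. pm_scale (c x) (e x))"
      using eq[of p "\<Sum>x\<in>X. pm_scale (c x) (e x)"] p(1) tensor_power_subset[of B k] sumc[of X c]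
      by (auto simp: T_def)
    then show "u \<in> ?W X" using p by blast
  next
    fix u assume "u \<in> ?W X"
    then obtain c where u: "u = h (\<Sum>x\<in>X. pm_scale (c x) (e x))" by auto
    have "Poly_Mapping.keys (\<Sum>x\<in>X. pm_scale (c x) (e x)) \<subseteq> (\<Union>x\<in>X. Poly_Mapping.keys (pm_scale (c x) (e x)))"
      by (rule keys_sum)
    also have "\<dots> \<subseteq> {w \<in> lists B. length w = k}"
      using X(2) by (fastforce simp: tensor_power_def in_keys_iff subset_iff)
    finally show "u \<in> quadratic_component B R k"
      using u by (auto simp: quadratic_component_def h_def I_def T_def tensor_power_def)
  qed
  ultimately have d: "h.S.dimension (card X) K (quadratic_component B R k)" by simp
  show "ring.finite_dimension (quadratic_algebra B R) (quadratic_scalars B R) (quadratic_component B R k)"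
    using h.S.finite_dimensionI[OF d] by (simp add: Q_def K_def)
  show "ring.dim (quadratic_algebra B R) (quadratic_scalars B R) (quadratic_component B R k) = card X"
    using h.S.dimI[OF Ksub d] by (simp add: Q_def K_def over_def)
qed

section \<open>Functionals on words of sets\<close>

text \<open>The sign of an exterior product: placing \<open>l\<close> in front of the elements of
  \<open>D\<close>, written in decreasing order, and sorting costs one transposition for each
  element of \<open>D\<close> above \<open>l\<close>.\<close>

definition insertion_sign :: "nat \<Rightarrow> nat set \<Rightarrow> 'f::field" where
  "insertion_sign l D = (- 1) ^ card {d \<in> D. l < d}"

lemma insertion_sign_empty [simp]: "insertion_sign l {} = 1"
  by (simp add: insertion_sign_def)

lemma insertion_sign_square [simp]: "insertion_sign l D * insertion_sign l D = 1"
  by (simp add: insertion_sign_def flip: power_mult_distrib)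

lemma insertion_sign_Max: "(\<And>d. d \<in> D \<Longrightarrow> d < l) \<Longrightarrow> insertion_sign l D = 1"
proof -
  assume "\<And>d. d \<in> D \<Longrightarrow> d < l"
  then have "{d \<in> D. l < d} = {}" by fastforce
  then show ?thesis by (simp only: insertion_sign_def card.empty power_0)
qed

lemma insertion_sign_insert_less:
  "k < l \<Longrightarrow> insertion_sign l (insert k D) = insertion_sign l D"
  unfolding insertion_sign_def by (rule arg_cong[where f = "\<lambda>X. (- 1) ^ card X"]) auto

lemma insertion_sign_insert_greater:
  assumes "l < k" "k \<notin> D" "finite D"
  shows "insertion_sign l (insert k D) = - insertion_sign l D"
proof -
  have "{d \<in> insert k D. l < d} = insert k {d \<in> D. l < d}" using assms by auto
  then show ?thesis using assms by (simp add: insertion_sign_def)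
qed

lemma insertion_sign_swap:
  assumes "l \<noteq> k" "l \<notin> D" "k \<notin> D" "finite D"
  shows "insertion_sign l D * insertion_sign k (insert l D) =
    - (insertion_sign k D * insertion_sign l (insert k D) :: 'f::field)"
  using assms by (cases l k rule: linorder_cases)
    (auto simp: insertion_sign_insert_less insertion_sign_insert_greater)

text \<open>Swapping the summation order would only show that the sum equals its own negative, which
  is not enough in characteristic 2. The induction cancels the terms \<open>h a l\<close> and
  \<open>h l a\<close> pairwise instead.\<close>

lemma sum_antisymmetric_eq_0:
  fixes h :: "'a \<Rightarrow> 'a \<Rightarrow> 'f::ab_group_add"
  assumes "finite A" and "\<And>l k. l \<in> A \<Longrightarrow> k \<in> A \<Longrightarrow> l \<noteq> k \<Longrightarrow> h l k = - h k l"
  shows "(\<Sum>l\<in>A. \<Sum>k\<in>A - {l}. h l k) = 0"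
  using assms
proof (induction A rule: finite_induct)
  case (insert a A)
  have "(\<Sum>k\<in>insert a A - {l}. h l k) = h l a + (\<Sum>k\<in>A - {l}. h l k)" if "l \<in> A" for l
  proof -
    have "insert a A - {l} = insert a (A - {l})" "a \<notin> A - {l}" using that insert.hyps by auto
    then show ?thesis using insert.hyps by simp
  qed
  moreover have "insert a A - {a} = A" using insert.hyps by auto
  ultimately have "(\<Sum>l\<in>insert a A. \<Sum>k\<in>insert a A - {l}. h l k) =
      (\<Sum>k\<in>A. h a k) + (\<Sum>l\<in>A. h l a + (\<Sum>k\<in>A - {l}. h l k))"
    using insert.hyps by simp
  also have "\<dots> = (\<Sum>l\<in>A. h a l + h l a) + (\<Sum>l\<in>A. \<Sum>k\<in>A - {l}. h l k)"
    by (simp add: sum.distrib algebra_simps)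
  also have "(\<Sum>l\<in>A. h a l + h l a) = 0"
  proof (intro sum.neutral ballI)
    fix l assume "l \<in> A"
    then have "h a l = - h l a" using insert.hyps by (intro insert.prems) auto
    then show "h a l + h l a = 0" by simp
  qed
  also have "(\<Sum>l\<in>A. \<Sum>k\<in>A - {l}. h l k) = 0"
    by (rule insert.IH) (rule insert.prems; simp)
  finally show ?case by simp
qed simp

section \<open>Operators that insert an element into \<open>D\<close>, and their commutation
  rules\<close>

definition up :: "nat set \<Rightarrow> (nat set \<Rightarrow> nat set \<Rightarrow> 'f::field) \<Rightarrow> nat set \<Rightarrow> nat set \<Rightarrow> 'f" where
  "up U g C D = (\<Sum>l\<in>U - (C \<union> D). insertion_sign l D * g C (insert l D))"

definition down :: "(nat set \<Rightarrow> nat set \<Rightarrow> 'f::field) \<Rightarrow> nat set \<Rightarrow> nat set \<Rightarrow> 'f" where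
  "down g C D = (\<Sum>i\<in>C. insertion_sign i D * g (C - {i}) (insert i D))"

definition restr :: "nat set \<Rightarrow> (nat set \<Rightarrow> nat set \<Rightarrow> 'f::field) \<Rightarrow> nat set \<Rightarrow> nat set \<Rightarrow> 'f" where
  "restr B g C D = (if C \<union> D = B then g C D else 0)"

definition act :: "nat set \<Rightarrow> nat set \<Rightarrow> (nat set \<Rightarrow> nat set \<Rightarrow> 'f::field) \<Rightarrow> nat set \<Rightarrow> nat set \<Rightarrow> 'f" where
  "act U B g C D = up U (restr B g) C D - restr B (up U g) C D"

lemma up_up:
  assumes "finite U" "finite D"
  shows "up U (up U g) C D = 0"
proof -
  let ?S = "U - (C \<union> D)"
  have "U - (C \<union> insert l D) = ?S - {l}" for l by auto
  then have "up U (up U g) C D = (\<Sum>l\<in>?S. \<Sum>k\<in>?S - {l}.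
      insertion_sign l D * insertion_sign k (insert l D) * g C (insert k (insert l D)))"
    by (simp add: up_def sum_distrib_left mult.assoc)
  also have "\<dots> = 0"
  proof (rule sum_antisymmetric_eq_0)
    fix l k assume "l \<in> ?S" "k \<in> ?S" "l \<noteq> k"
    then show "insertion_sign l D * insertion_sign k (insert l D) * g C (insert k (insert l D)) =
      - (insertion_sign k D * insertion_sign l (insert k D) * g C (insert l (insert k D)))"
      using insertion_sign_swap[of l k D, where 'f = 'a] assms by (simp add: insert_commute)
  qed (use assms in auto)
  finally show ?thesis .
qed

lemma down_down:
  assumes "finite C" "finite D" "C \<inter> D = {}"
  shows "down (down g) C D = 0"
proof -
  have "down (down g) C D = (\<Sum>l\<in>C. \<Sum>k\<in>C - {l}.
      insertion_sign l D * insertion_sign k (insert l D) * g (C - {l} - {k}) (insert k (insert l D)))"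
    by (simp add: down_def sum_distrib_left mult.assoc)
  also have "\<dots> = 0"
  proof (rule sum_antisymmetric_eq_0)
    fix l k assume *: "l \<in> C" "k \<in> C" "l \<noteq> k"
    have "C - {l} - {k} = C - {k} - {l}" by auto
    moreover have "l \<notin> D" "k \<notin> D" using * assms by auto
    ultimately show "insertion_sign l D * insertion_sign k (insert l D) * g (C - {l} - {k}) (insert k (insert l D)) =
      - (insertion_sign k D * insertion_sign l (insert k D) * g (C - {k} - {l}) (insert l (insert k D)))"
      using insertion_sign_swap[of l k D, where 'f = 'a] assms * by (simp add: insert_commute)
  qed (use assms in auto)
  finally show ?thesis .
qed

text \<open>Both composites insert some \<open>i\<close> from \<open>C\<close> and some
  \<open>l\<close> from outside \<open>C \<union> D\<close> into \<open>D\<close>, in opposite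
  orders; exchanging the two insertions changes the sign.\<close>

lemma down_up:
  assumes "finite D" "C \<inter> D = {}"
  shows "down (up U g) C D = - up U (down g) C D"
proof -
  let ?S = "U - (C \<union> D)"
  have "U - (C - {i} \<union> insert i D) = ?S" if "i \<in> C" for i using that by auto
  then have "down (up U g) C D = (\<Sum>i\<in>C. \<Sum>l\<in>?S.
      insertion_sign i D * insertion_sign l (insert i D) * g (C - {i}) (insert l (insert i D)))"
    by (simp add: up_def down_def sum_distrib_left mult.assoc)
  also have "\<dots> = (\<Sum>i\<in>C. \<Sum>l\<in>?S.
      - (insertion_sign l D * insertion_sign i (insert l D) * g (C - {i}) (insert i (insert l D))))"
  proof (intro sum.cong refl)
    fix i l assume *: "i \<in> C" "l \<in> ?S"
    then have "i \<noteq> l" "i \<notin> D" "l \<notin> D" using assms by auto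
    then show "insertion_sign i D * insertion_sign l (insert i D) * g (C - {i}) (insert l (insert i D)) =
      - (insertion_sign l D * insertion_sign i (insert l D) * g (C - {i}) (insert i (insert l D)))"
      using insertion_sign_swap[of i l D, where 'f = 'a] assms(1) by (simp add: insert_commute)
  qed
  also have "\<dots> = - up U (down g) C D"
    by (subst sum.swap) (simp add: up_def down_def sum_distrib_left mult.assoc sum_negf)
  finally show ?thesis .
qed

text \<open>Moving an element from \<open>C\<close> to \<open>D\<close> does not change
  \<open>C \<union> D\<close>.\<close>

lemma down_restr: "down (restr B g) C D = restr B (down g) C D"
proof -
  have "C - {i} \<union> insert i D = C \<union> D" if "i \<in> C" for i using that by auto
  then show ?thesis by (simp add: down_def restr_def)
qed

text \<open>Compatibility with the linear relations among the \<open>E(C, D)\<close>; it makes \<open>word_functional\<close> below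
  vanish on the ideal.\<close>

definition balanced :: "nat set \<Rightarrow> (nat set \<Rightarrow> nat set \<Rightarrow> 'f::field) \<Rightarrow> bool" where
  "balanced U g \<longleftrightarrow> (\<forall>C D. C \<subseteq> U \<longrightarrow> D \<subseteq> U \<longrightarrow> C \<inter> D = {} \<longrightarrow> 2 \<le> card C \<longrightarrow> down g C D = up U g C D)"

text \<open>A formal computation with \<open>up\<close> squared being zero, \<open>down\<close>
  anticommuting with \<open>up\<close> and commuting with \<open>restr B\<close>. Applied to
  \<open>act U B g\<close>, both \<open>down\<close> and \<open>up\<close> reduce to minus
  \<open>up\<close> after \<open>restr B\<close> after \<open>up\<close>, evaluated on
  \<open>g\<close>.\<close>

lemma balanced_act:
  assumes U: "finite U" and g: "balanced U g"
  shows "balanced U (act U B g)"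
  unfolding balanced_def
proof (intro allI impI)
  fix C D assume CD: "C \<subseteq> U" "D \<subseteq> U" "C \<inter> D = {}" "2 \<le> card C"
  have fin: "finite C" "finite D" using CD U finite_subset by auto
  \<comment> \<open>\<open>up\<close> and \<open>restr\<close> keep \<open>C\<close>, so the bound
    on \<open>card C\<close> persists and balancedness of \<open>g\<close> is available at every
    pair that occurs.\<close>
  have g': "down g C E = up U g C E" if "E \<subseteq> U" "C \<inter> E = {}" for E
    using g CD that by (auto simp: balanced_def)
  have 1: "up U (restr B (down g)) C D = up U (restr B (up U g)) C D"
    unfolding up_def[of U "restr B (down g)"] up_def[of U "restr B (up U g)"]
    by (intro sum.cong refl) (use CD in \<open>auto simp: restr_def intro!: g'\<close>)
  have 2: "up U (down g) C D = up U (up U g) C D"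
    unfolding up_def[of U "down g"] up_def[of U "up U g"]
    by (intro sum.cong refl) (use CD in \<open>auto intro!: g'\<close>)
  have "down (restr B (up U g)) C D = 0"
    unfolding down_restr using down_up[of D C U g] 2 up_up[of U D g C] U fin CD
    by (simp add: restr_def)
  moreover have "down (act U B g) C D = down (up U (restr B g)) C D - down (restr B (up U g)) C D"
    unfolding down_def act_def by (simp add: algebra_simps sum_subtractf)
  ultimately have "down (act U B g) C D = - up U (down (restr B g)) C D"
    using down_up[of D C U "restr B g"] fin CD by simp
  also have "down (restr B g) = restr B (down g)" by (intro ext) (rule down_restr)
  also have "- up U (restr B (down g)) C D = - up U (restr B (up U g)) C D" using 1 by simp
  also have "\<dots> = up U (up U (restr B g)) C D - up U (restr B (up U g)) C D"
    using up_up[of U D "restr B g" C] U fin by simp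
  also have "\<dots> = up U (act U B g) C D"
    unfolding act_def up_def[of U "\<lambda>C D. up U (restr B g) C D - restr B (up U g) C D"]
      up_def[of U "up U (restr B g)"] up_def[of U "restr B (up U g)"]
    by (simp add: algebra_simps sum_subtractf)
  finally show "down (act U B g) C D = up U (act U B g) C D" .
qed

text \<open>Both halves of the commutator run over the same insertions. One asks that the union be
  \<open>B\<close> after the insertion, the other that it be \<open>B\<close> before.\<close>

lemma act_altdef:
  "act U B g C D = (\<Sum>l\<in>U - (C \<union> D). insertion_sign l D *
     (of_bool (insert l (C \<union> D) = B) - of_bool (C \<union> D = B)) * g C (insert l D))"
proof -
  have "restr B (up U g) C D =
      (\<Sum>l\<in>U - (C \<union> D). insertion_sign l D * of_bool (C \<union> D = B) * g C (insert l D))"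
    by (simp add: restr_def up_def)
  moreover have "up U (restr B g) C D =
      (\<Sum>l\<in>U - (C \<union> D). insertion_sign l D * of_bool (insert l (C \<union> D) = B) * g C (insert l D))"
    unfolding up_def by (rule sum.cong) (auto simp: restr_def)
  ultimately show ?thesis
    by (simp only: act_def sum_subtractf[symmetric] left_diff_distrib right_diff_distrib)
qed

text \<open>Each letter but the last is absorbed by its operator \<open>act\<close>, from left to
  right, and the last letter picks the value at a pair with empty second component. The functional
  serves the positive degrees; degree 0 is settled separately through the constant term.\<close>

fun word_functional :: "nat set \<Rightarrow> (nat set \<Rightarrow> nat set \<Rightarrow> 'f::field) \<Rightarrow> nat set list \<Rightarrow> 'f" where
  "word_functional U g [] = 0"
| "word_functional U g [B] = g B {}"
| "word_functional U g (B # B' # w) = word_functional U (act U B g) (B' # w)"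

lemma word_functional_Cons:
  "w \<noteq> [] \<Longrightarrow> word_functional U g (B # w) = word_functional U (act U B g) w"
  by (cases w) auto

lemma word_functional_add:
  "word_functional U (\<lambda>C D. g C D + h C D) w = word_functional U g w + word_functional U h w"
proof (induction w arbitrary: g h)
  case (Cons B w)
  have "act U B (\<lambda>C D. g C D + h C D) = (\<lambda>C D. act U B g C D + act U B h C D)"
    by (intro ext) (simp only: act_altdef sum.distrib[symmetric] distrib_left)
  then show ?case using Cons by (cases w) auto
qed simp

lemma word_functional_mult:
  "word_functional U (\<lambda>C D. c * g C D) w = c * word_functional U g w"
proof (induction w arbitrary: g)
  case (Cons B w)
  have "act U B (\<lambda>C D. c * g C D) = (\<lambda>C D. c * act U B g C D)"
    by (intro ext) (simp add: act_altdef sum_distrib_left mult.left_commute)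
  then show ?case using Cons by (cases w) auto
qed simp

lemma word_functional_sum:
  "word_functional U (\<lambda>C D. \<Sum>x\<in>X. g x C D) w = (\<Sum>x\<in>X. word_functional U (g x) w)"
proof (induction X rule: infinite_finite_induct)
  case (insert x X)
  then show ?case by (simp add: word_functional_add)
qed (use word_functional_mult[of U 0 "\<lambda>C D. 0" w] in auto)

definition nonempty_subsets :: "'a set \<Rightarrow> 'a set set" where
  "nonempty_subsets U = {A. A \<noteq> {} \<and> A \<subseteq> U}"

lemma finite_nonempty_subsets: "finite U \<Longrightarrow> finite (nonempty_subsets U)"
  by (rule finite_subset[of _ "Pow U"]) (auto simp: nonempty_subsets_def)

text \<open>\<open>act\<close> keeps \<open>C\<close> and inserts into \<open>D\<close> only
  elements outside \<open>C \<union> D\<close>. Starting from a final letter paired with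
  \<open>{}\<close>, only disjoint pairs inside \<open>U\<close> with \<open>C\<close> nonempty are
  ever consulted.\<close>

lemma word_functional_eq_0:
  assumes "\<And>C D. C \<noteq> {} \<Longrightarrow> C \<subseteq> U \<Longrightarrow> D \<subseteq> U \<Longrightarrow> C \<inter> D = {} \<Longrightarrow> g C D = 0"
    and "set w \<subseteq> nonempty_subsets U"
  shows "word_functional U g w = 0"
  using assms
proof (induction w arbitrary: g)
  case (Cons B w)
  have "act U B g C D = 0" if "C \<noteq> {}" "C \<subseteq> U" "D \<subseteq> U" "C \<inter> D = {}" for C D
    unfolding act_altdef by (rule sum.neutral) (use that in \<open>auto intro!: Cons.prems(1)\<close>)
  then have "word_functional U (act U B g) w = 0" using Cons by auto
  then show ?case using Cons by (cases w) (auto simp: nonempty_subsets_def)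
qed simp

section \<open>Vanishing of the functionals on the quadratic relations\<close>

text \<open>The condition that the pairing with \<open>\<V>(A:{i,j})\<close> vanishes, for the
  element of \<open>V\<^sup>* \<otimes> V\<^sup>*\<close> with coefficients \<open>\<rho>\<close>.\<close>

definition quadratic_dual_coeffs :: "nat set \<Rightarrow> (nat set \<Rightarrow> nat set \<Rightarrow> 'f::field) \<Rightarrow> bool" where
  "quadratic_dual_coeffs U \<rho> \<longleftrightarrow>
    (\<forall>A. \<rho> A {} = 0 \<and> \<rho> {} A = 0) \<and>
    (\<forall>A i j. A \<subseteq> U \<longrightarrow> i \<in> A \<longrightarrow> j \<in> A \<longrightarrow> i \<noteq> j \<longrightarrow>
      \<rho> A (A - {i}) + \<rho> (A - {i}) (A - {i, j}) - \<rho> (A - {i}) (A - {i}) =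
      \<rho> A (A - {j}) + \<rho> (A - {j}) (A - {i, j}) - \<rho> (A - {j}) (A - {j}))"

lemma sum_of_bool_diff:
  fixes f :: "'a \<Rightarrow> 'f::comm_ring_1"
  assumes "finite S" "p \<in> S" "q \<in> S"
  shows "(\<Sum>x\<in>S. f x * (of_bool (p = x) - of_bool (q = x))) = f p - f q"
proof -
  have "(\<Sum>x\<in>S. f x * of_bool (p = x)) = f p" if "p \<in> S" for p
  proof -
    have "(\<Sum>x\<in>S. f x * of_bool (p = x)) = (\<Sum>x\<in>S. if x = p then f x else 0)"
      by (rule sum.cong) auto
    then show ?thesis using assms that by (simp add: sum.delta)
  qed
  then show ?thesis using assms by (simp add: right_diff_distrib sum_subtractf)
qed

text \<open>The case of a relation followed by further letters. The two operators insert
  \<open>l\<close> and then \<open>k\<close>; the signed value of \<open>g\<close> is antisymmetric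
  in \<open>l\<close> and \<open>k\<close>, while the condition on \<open>\<rho>\<close> makes its
  coefficient symmetric. Balancedness of \<open>g\<close> does not enter.\<close>

lemma quadratic_dual_coeffs_act_act:
  fixes g :: "nat set \<Rightarrow> nat set \<Rightarrow> 'f::field"
  assumes U: "finite U" and \<rho>: "quadratic_dual_coeffs U \<rho>"
    and CD: "C \<noteq> {}" "C \<subseteq> U" "D \<subseteq> U" "C \<inter> D = {}"
  shows "(\<Sum>A\<in>nonempty_subsets U. \<Sum>B\<in>nonempty_subsets U. \<rho> A B * act U B (act U A g) C D) = 0"
proof -
  let ?N = "nonempty_subsets U" and ?X = "C \<union> D"
  let ?S = "U - ?X"
  have fin: "finite ?N" "finite D"
    using finite_nonempty_subsets[OF U] finite_subset[OF CD(3) U] by auto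
  let ?e = "\<lambda>l k. insertion_sign l D * insertion_sign k (insert l D) * g C (insert k (insert l D))"
  let ?b = "\<lambda>l B. of_bool (insert l ?X = B) - of_bool (?X = B) :: 'f"
  let ?a = "\<lambda>l k A. of_bool (insert k (insert l ?X) = A) - of_bool (insert l ?X = A) :: 'f"
  let ?t = "\<lambda>l k. \<rho> (insert k (insert l ?X)) (insert l ?X) - \<rho> (insert l ?X) (insert l ?X)
      - \<rho> (insert k (insert l ?X)) ?X + \<rho> (insert l ?X) ?X"
  have S: "U - (C \<union> insert l D) = ?S - {l}" for l by auto
  have act2: "act U B (act U A g) C D = (\<Sum>l\<in>?S. \<Sum>k\<in>?S - {l}. ?e l k * (?b l B * ?a l k A))" for A B
    unfolding act_altdef[of U B] act_altdef[of U A] S sum_distrib_left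
    by (intro sum.cong refl) (simp add: mult_ac)
  have inner: "(\<Sum>A\<in>?N. \<Sum>B\<in>?N. \<rho> A B * (?b l B * ?a l k A)) = ?t l k"
    if "l \<in> ?S" "k \<in> ?S - {l}" for l k
  proof -
    have N: "?X \<in> ?N" "insert l ?X \<in> ?N" "insert k (insert l ?X) \<in> ?N"
      using that CD by (auto simp: nonempty_subsets_def)
    have "(\<Sum>A\<in>?N. \<Sum>B\<in>?N. \<rho> A B * (?b l B * ?a l k A)) = (\<Sum>A\<in>?N. (\<Sum>B\<in>?N. \<rho> A B * ?b l B) * ?a l k A)"
      by (simp add: sum_distrib_right mult.assoc)
    also have "\<dots> = (\<Sum>A\<in>?N. (\<rho> A (insert l ?X) - \<rho> A ?X) * ?a l k A)"
      by (simp only: sum_of_bool_diff[OF fin(1) N(2) N(1)])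
    also have "\<dots> = ?t l k"
      by (simp only: sum_of_bool_diff[OF fin(1) N(3) N(2)]) simp
    finally show ?thesis .
  qed
  have "(\<Sum>A\<in>?N. \<Sum>B\<in>?N. \<rho> A B * act U B (act U A g) C D) =
      (\<Sum>A\<in>?N. \<Sum>B\<in>?N. \<Sum>l\<in>?S. \<Sum>k\<in>?S - {l}. ?e l k * (\<rho> A B * (?b l B * ?a l k A)))"
    unfolding act2 sum_distrib_left by (intro sum.cong refl) (simp add: mult_ac)
  also have "\<dots> = (\<Sum>A\<in>?N. \<Sum>l\<in>?S. \<Sum>k\<in>?S - {l}. \<Sum>B\<in>?N. ?e l k * (\<rho> A B * (?b l B * ?a l k A)))"
    by (intro sum.cong refl, subst sum.swap, intro sum.cong refl, rule sum.swap)
  also have "\<dots> = (\<Sum>l\<in>?S. \<Sum>k\<in>?S - {l}. \<Sum>A\<in>?N. \<Sum>B\<in>?N. ?e l k * (\<rho> A B * (?b l B * ?a l k A)))"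
    by (subst sum.swap, intro sum.cong refl, rule sum.swap)
  also have "\<dots> = (\<Sum>l\<in>?S. \<Sum>k\<in>?S - {l}. ?e l k * ?t l k)"
    by (intro sum.cong refl) (simp add: sum_distrib_left[symmetric] inner)
  also have "\<dots> = 0"
  proof (rule sum_antisymmetric_eq_0)
    fix l k assume lk: "l \<in> ?S" "k \<in> ?S" "l \<noteq> k"
    have "?e l k = - ?e k l"
      using insertion_sign_swap[of l k D, where 'f = 'f] fin lk by (simp add: insert_commute)
    \<comment> \<open>For \<open>A\<close> equal to \<open>C \<union> D\<close> together with
      \<open>l\<close> and \<open>k\<close>, three terms of \<open>?t l k\<close> form one side of
      the condition on \<open>\<rho>\<close> at \<open>A\<close>, and the remaining one, the
      coefficient at \<open>A\<close> and \<open>C \<union> D\<close>, is visibly symmetric.\<close>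
    moreover have "?t l k = ?t k l"
    proof -
      let ?A = "insert k (insert l ?X)"
      have *: "?A - {k} = insert l ?X" "?A - {l} = insert k ?X" "?A - {k, l} = ?X"
        using lk by auto
      have "?A \<subseteq> U" using lk CD by auto
      then have "\<rho> ?A (?A - {k}) + \<rho> (?A - {k}) (?A - {k, l}) - \<rho> (?A - {k}) (?A - {k}) =
        \<rho> ?A (?A - {l}) + \<rho> (?A - {l}) (?A - {k, l}) - \<rho> (?A - {l}) (?A - {l})"
        using \<rho> lk unfolding quadratic_dual_coeffs_def by blast
      from this[unfolded *] show ?thesis by (simp add: insert_commute algebra_simps)
    qed
    ultimately show "?e l k * ?t l k = - (?e k l * ?t k l)" by simp
  qed (use U in auto)
  finally show ?thesis .
qed

text \<open>A discrete Poincare lemma on the cube of subsets of \<open>U\<close>: an edge function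
  whose sums agree along the two routes through every square is the difference of a vertex function.
  The potential sums \<open>M\<close> along the route that adds the elements of \<open>A\<close> in
  increasing order.\<close>

lemma exists_potential:
  fixes M :: "nat set \<Rightarrow> nat \<Rightarrow> 'f::ab_group_add"
  assumes U: "finite U"
    and M: "\<And>A i j. A \<subseteq> U \<Longrightarrow> i \<in> A \<Longrightarrow> j \<in> A \<Longrightarrow> i \<noteq> j \<Longrightarrow>
      M (A - {i}) i + M (A - {i, j}) j = M (A - {j}) j + M (A - {i, j}) i"
  shows "\<exists>\<beta>. \<beta> {} = 0 \<and> (\<forall>A i. A \<subseteq> U \<longrightarrow> i \<in> A \<longrightarrow> \<beta> A = M (A - {i}) i + \<beta> (A - {i}))"
proof -
  define \<beta> where "\<beta> A = (\<Sum>i\<in>A. M {a \<in> A. a < i} i)" for A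
  have top: "\<beta> A = M (A - {Max A}) (Max A) + \<beta> (A - {Max A})" if "A \<subseteq> U" "A \<noteq> {}" for A
  proof -
    let ?m = "Max A"
    have A: "finite A" using that U finite_subset by auto
    have m: "?m \<in> A" "\<And>a. a \<in> A \<Longrightarrow> a \<le> ?m" using A that by auto
    have "\<beta> A = M {a \<in> A. a < ?m} ?m + (\<Sum>i\<in>A - {?m}. M {a \<in> A. a < i} i)"
      unfolding \<beta>_def by (rule sum.remove) (use A m in auto)
    also have "{a \<in> A. a < ?m} = A - {?m}" using m(2) by (auto simp: less_le)
    also have "(\<Sum>i\<in>A - {?m}. M {a \<in> A. a < i} i) = \<beta> (A - {?m})"
      unfolding \<beta>_def
    proof (rule sum.cong[OF refl])
      fix i assume "i \<in> A - {?m}"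
      then have "{a \<in> A. a < i} = {a \<in> A - {?m}. a < i}" using m(2) by fastforce
      then show "M {a \<in> A. a < i} i = M {a \<in> A - {?m}. a < i} i" by simp
    qed
    finally show ?thesis .
  qed
  have "\<beta> A = M (A - {i}) i + \<beta> (A - {i})" if "A \<subseteq> U" "i \<in> A" for A i
    using that
  proof (induction "card A" arbitrary: A i rule: less_induct)
    case less
    let ?m = "Max A"
    have A: "finite A" using less.prems U finite_subset by auto
    have m: "?m \<in> A" using A less.prems by (intro Max_in) auto
    show ?case
    proof (cases "i = ?m")
      case True
      then show ?thesis using top less.prems by auto
    next
      case False
      have c: "card (A - {x}) < card A" if "x \<in> A" for x using that A by (rule card_Diff1_less[rotated])
      \<comment> \<open>The induction hypothesis treats the sets with \<open>i\<close> or
        \<open>Max A\<close> removed; the square spanned by \<open>i\<close> and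
        \<open>Max A\<close> then compares the two routes to \<open>A\<close>.\<close>
      have "\<beta> (A - {i}) = M (A - {i} - {?m}) ?m + \<beta> (A - {i} - {?m})"
        using less.prems m False by (intro less.hyps c) auto
      moreover have "\<beta> (A - {?m}) = M (A - {?m} - {i}) i + \<beta> (A - {?m} - {i})"
        using less.prems m False by (intro less.hyps c) auto
      moreover have "A - {i} - {?m} = A - {i, ?m}" "A - {?m} - {i} = A - {i, ?m}" by auto
      moreover have "\<beta> A = M (A - {?m}) ?m + \<beta> (A - {?m})" using top less.prems by auto
      ultimately show ?thesis using M[of A i ?m] less.prems m False
        by (simp add: add.assoc[symmetric])
    qed
  qed
  moreover have "\<beta> {} = 0" by (simp add: \<beta>_def)
  ultimately show ?thesis by blast
qed

text \<open>The case of a relation at the end of a word. Its coefficients give an edge function on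
  subsets, which the condition on \<open>\<rho>\<close> makes the difference of a potential
  \<open>\<beta>\<close>. Summation by parts turns the sum into the pairing of
  \<open>\<beta>\<close> with \<open>down g\<close> minus \<open>up U g\<close> at pairs
  \<open>(C, {})\<close>, where balancedness applies.\<close>

lemma quadratic_dual_coeffs_act:
  fixes g :: "nat set \<Rightarrow> nat set \<Rightarrow> 'f::field"
  assumes U: "finite U" and \<rho>: "quadratic_dual_coeffs U \<rho>" and g: "balanced U g"
  shows "(\<Sum>A\<in>nonempty_subsets U. \<Sum>B\<in>nonempty_subsets U. \<rho> A B * act U A g B {}) = 0"
proof -
  let ?N = "nonempty_subsets U"
  have finN: "finite ?N" using U by (rule finite_nonempty_subsets)
  define M where "M B l = \<rho> (insert l B) B - \<rho> B B" for B l
  have Mrec: "M (A - {i}) i + M (A - {i, j}) j = M (A - {j}) j + M (A - {i, j}) i"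
    if "A \<subseteq> U" "i \<in> A" "j \<in> A" "i \<noteq> j" for A i j
  proof -
    have *: "insert i (A - {i}) = A" "insert j (A - {j}) = A"
      "insert j (A - {i, j}) = A - {i}" "insert i (A - {i, j}) = A - {j}"
      using that by auto
    have "\<rho> A (A - {i}) + \<rho> (A - {i}) (A - {i, j}) - \<rho> (A - {i}) (A - {i}) =
      \<rho> A (A - {j}) + \<rho> (A - {j}) (A - {i, j}) - \<rho> (A - {j}) (A - {j})"
      using \<rho> that unfolding quadratic_dual_coeffs_def by blast
    then show ?thesis unfolding M_def * by (simp add: algebra_simps)
  qed
  obtain \<beta> where \<beta>0: "\<beta> {} = 0"
    and \<beta>: "\<And>A i. A \<subseteq> U \<Longrightarrow> i \<in> A \<Longrightarrow> \<beta> A = M (A - {i}) i + \<beta> (A - {i})"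
    using exists_potential[OF U, of M] Mrec by metis
  \<comment> \<open>Balancedness says nothing about singletons, so \<open>\<beta>\<close> has to
    vanish there. It does, because \<open>\<rho>\<close> is zero whenever one of its arguments is
    empty.\<close>
  have \<beta>1: "\<beta> C = 0" if "C \<in> ?N" "\<not> 2 \<le> card C" for C
  proof -
    have "card C \<noteq> 0" using that U finite_subset[of C U] by (auto simp: nonempty_subsets_def)
    then have "card C = 1" using that by linarith
    then obtain c where c: "C = {c}" by (auto simp: card_1_singleton_iff)
    have "C \<subseteq> U" "c \<in> C" using that c by (auto simp: nonempty_subsets_def)
    from \<beta>[OF this] show ?thesis using c \<beta>0 \<rho> by (simp add: M_def quadratic_dual_coeffs_def)
  qed
  have "(\<Sum>A\<in>?N. \<Sum>B\<in>?N. \<rho> A B * act U A g B {}) =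
      (\<Sum>B\<in>?N. \<Sum>A\<in>?N. \<Sum>l\<in>U - B. g B {l} * (\<rho> A B * (of_bool (insert l B = A) - of_bool (B = A))))"
  proof (subst sum.swap, intro sum.cong refl)
    fix B A assume "B \<in> ?N" "A \<in> ?N"
    have "act U A g B {} = (\<Sum>l\<in>U - B. (of_bool (insert l B = A) - of_bool (B = A)) * g B {l})"
      by (simp add: act_altdef)
    then show "\<rho> A B * act U A g B {} =
        (\<Sum>l\<in>U - B. g B {l} * (\<rho> A B * (of_bool (insert l B = A) - of_bool (B = A))))"
      by (simp only: sum_distrib_left mult_ac)
  qed
  also have "\<dots> = (\<Sum>B\<in>?N. \<Sum>l\<in>U - B. g B {l} * M B l)"
  proof (rule sum.cong[OF refl])
    fix B assume B: "B \<in> ?N"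
    have "(\<Sum>A\<in>?N. \<rho> A B * (of_bool (insert l B = A) - of_bool (B = A))) = M B l"
      if "l \<in> U - B" for l
      unfolding M_def by (rule sum_of_bool_diff) (use that B finN in \<open>auto simp: nonempty_subsets_def\<close>)
    then show "(\<Sum>A\<in>?N. \<Sum>l\<in>U - B. g B {l} * (\<rho> A B * (of_bool (insert l B = A) - of_bool (B = A)))) =
      (\<Sum>l\<in>U - B. g B {l} * M B l)"
      by (subst sum.swap, intro sum.cong refl) (simp only: sum_distrib_left[symmetric])
  qed
  also have "\<dots> = (\<Sum>B\<in>?N. \<Sum>l\<in>U - B. \<beta> (insert l B) * g B {l} - \<beta> B * g B {l})"
  proof (intro sum.cong refl)
    fix B l assume *: "B \<in> ?N" "l \<in> U - B"
    have "\<beta> (insert l B) = M (insert l B - {l}) l + \<beta> (insert l B - {l})"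
      by (rule \<beta>) (use * in \<open>auto simp: nonempty_subsets_def\<close>)
    moreover have "insert l B - {l} = B" using * by auto
    ultimately show "g B {l} * M B l = \<beta> (insert l B) * g B {l} - \<beta> B * g B {l}"
      by (simp add: algebra_simps)
  qed
  also have "\<dots> = (\<Sum>B\<in>?N. \<Sum>l\<in>U - B. \<beta> (insert l B) * g B {l}) - (\<Sum>B\<in>?N. \<beta> B * up U g B {})"
    by (simp add: sum_subtractf up_def sum_distrib_left)
  also have "(\<Sum>B\<in>?N. \<Sum>l\<in>U - B. \<beta> (insert l B) * g B {l}) = (\<Sum>C\<in>?N. \<beta> C * down g C {})"
  proof -
    have "(\<Sum>B\<in>?N. \<Sum>l\<in>U - B. \<beta> (insert l B) * g B {l}) =
        (\<Sum>(B, l)\<in>Sigma ?N (\<lambda>B. U - B). \<beta> (insert l B) * g B {l})"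
      by (rule sum.Sigma) (use finN U in auto)
    \<comment> \<open>Edges are re-indexed by their upper end \<open>C\<close> and the added element
      \<open>i\<close>. The lower end is nonempty, hence exactly the sets \<open>C\<close> with at
      least two elements occur.\<close>
    also have "\<dots> = (\<Sum>(C, i)\<in>Sigma ?N (\<lambda>C. if 2 \<le> card C then C else {}). \<beta> C * g (C - {i}) {i})"
    proof (rule sum.reindex_bij_witness[of _ "\<lambda>(C, i). (C - {i}, i)" "\<lambda>(B, l). (insert l B, l)"])
      fix a assume "a \<in> Sigma ?N (\<lambda>C. if 2 \<le> card C then C else {})"
      then obtain C i where a: "a = (C, i)" "C \<in> ?N" "2 \<le> card C" "i \<in> C"
        by (auto split: if_splits)
      have "C - {i} \<noteq> {}"
      proof
        assume "C - {i} = {}"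
        then have "C = {i}" using a by auto
        then show False using a by simp
      qed
      then show "(case a of (C, i) \<Rightarrow> (C - {i}, i)) \<in> Sigma ?N (\<lambda>B. U - B)"
        using a by (auto simp: nonempty_subsets_def)
    next
      fix a assume "a \<in> Sigma ?N (\<lambda>B. U - B)"
      then obtain B l where a: "a = (B, l)" "B \<in> ?N" "l \<in> U" "l \<notin> B" by auto
      have "finite B" "B \<noteq> {}" using a U finite_subset by (auto simp: nonempty_subsets_def)
      then have "0 < card B" by auto
      then have "2 \<le> card (insert l B)" using \<open>finite B\<close> a by simp
      then show "(case a of (B, l) \<Rightarrow> (insert l B, l)) \<in> Sigma ?N (\<lambda>C. if 2 \<le> card C then C else {})"
        using a by (auto simp: nonempty_subsets_def)
    qed (auto simp: insert_absorb split: if_splits)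
    also have "\<dots> = (\<Sum>C\<in>?N. \<Sum>i\<in>(if 2 \<le> card C then C else {}). \<beta> C * g (C - {i}) {i})"
      by (rule sum.Sigma[symmetric]) (use finN U in \<open>auto simp: nonempty_subsets_def intro: finite_subset\<close>)
    also have "\<dots> = (\<Sum>C\<in>?N. \<beta> C * down g C {})"
      by (intro sum.cong refl) (auto simp: down_def sum_distrib_left \<beta>1)
    finally show ?thesis .
  qed
  also have "(\<Sum>C\<in>?N. \<beta> C * down g C {}) = (\<Sum>C\<in>?N. \<beta> C * up U g C {})"
  proof (rule sum.cong[OF refl])
    fix C assume C: "C \<in> ?N"
    show "\<beta> C * down g C {} = \<beta> C * up U g C {}"
      using \<beta>1[OF C] g C by (cases "2 \<le> card C") (auto simp: balanced_def nonempty_subsets_def)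
  qed
  finally show ?thesis by simp
qed

text \<open>Letters to the left of the relation are absorbed by \<open>act\<close>, which keeps
  \<open>g\<close> balanced. It remains to see whether letters follow the relation, and the two
  preceding computations cover the two cases.\<close>

lemma word_functional_annihilates:
  fixes g :: "nat set \<Rightarrow> nat set \<Rightarrow> 'f::field"
  assumes U: "finite U" and \<rho>: "quadratic_dual_coeffs U \<rho>" and g: "balanced U g"
    and v: "set v \<subseteq> nonempty_subsets U"
  shows "(\<Sum>A\<in>nonempty_subsets U. \<Sum>B\<in>nonempty_subsets U.
    \<rho> A B * word_functional U g (u @ [A, B] @ v)) = 0"
  using g
proof (induction u arbitrary: g)
  case Nil
  show ?case
  proof (cases "v = []")
    case True
    then show ?thesis using quadratic_dual_coeffs_act[OF U \<rho> Nil] by simp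
  next
    case False
    let ?N = "nonempty_subsets U"
    have "(\<Sum>A\<in>?N. \<Sum>B\<in>?N. \<rho> A B * word_functional U g ([] @ [A, B] @ v)) =
        word_functional U (\<lambda>C D. \<Sum>A\<in>?N. \<Sum>B\<in>?N. \<rho> A B * act U B (act U A g) C D) v"
      using False by (simp add: word_functional_sum word_functional_mult word_functional_Cons)
    also have "\<dots> = 0"
      by (rule word_functional_eq_0) (use v quadratic_dual_coeffs_act_act[OF U \<rho>] in auto)
    finally show ?thesis .
  qed
next
  case (Cons X u)
  then show ?case using balanced_act[OF U Cons.prems, of X] by (simp add: word_functional_Cons)
qed

section \<open>Basis words and their dual functionals\<close>

text \<open>The word of \<open>E(C, D)\<close>. Removing the largest element of \<open>D\<close>
  first selects one among the chains from \<open>C \<union> D\<close> to \<open>C\<close>; the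
  finiteness test secures termination.\<close>

function set_word :: "nat set \<Rightarrow> nat set \<Rightarrow> nat set list" where
  "set_word C D = (if finite D \<and> D \<noteq> {} then (C \<union> D) # set_word C (D - {Max D}) else [C])"
  by auto
termination
  by (relation "measure (\<lambda>(C, D). card D)") (auto simp: card_gt_0_iff)

declare set_word.simps [simp del]

lemma set_word_empty [simp]: "set_word C {} = [C]"
  by (subst set_word.simps) simp

lemma set_word_insert_Max:
  assumes "finite D" "\<And>d. d \<in> D \<Longrightarrow> d < m"
  shows "set_word C (insert m D) = insert m (C \<union> D) # set_word C D"
proof -
  have "Max (insert m D) = m"
    by (rule Max_eqI) (use assms in \<open>auto intro: less_imp_le\<close>)
  moreover have "insert m D - {m} = D" using assms(2) by auto
  ultimately show ?thesis using assms(1) by (subst set_word.simps) auto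
qed

lemma set_word_Cons: "finite D \<Longrightarrow> \<exists>w. set_word C D = (C \<union> D) # w"
  by (subst set_word.simps) auto

lemma length_set_word: "finite D \<Longrightarrow> length (set_word C D) = Suc (card D)"
proof (induction D rule: finite_linorder_max_induct)
  case (insert m D)
  then have "m \<notin> D" by auto
  with insert show ?case by (simp add: set_word_insert_Max)
qed simp

lemma set_set_word:
  assumes "finite D" "C \<in> nonempty_subsets U" "D \<subseteq> U"
  shows "set (set_word C D) \<subseteq> nonempty_subsets U"
  using assms
proof (induction D rule: finite_linorder_max_induct)
  case (insert m D)
  then show ?case by (auto simp: set_word_insert_Max nonempty_subsets_def)
qed simp

text \<open>The functional of \<open>g\<close> reads off \<open>g\<close> on these words, so a
  prescribed \<open>g\<close> has known values on them. At \<open>(C, D)\<close> the operator of the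
  leading letter admits only the insertion of \<open>m\<close>, whose sign is \<open>1\<close>
  because \<open>m\<close> exceeds all of \<open>D\<close>.\<close>

lemma word_functional_set_word:
  fixes g :: "nat set \<Rightarrow> nat set \<Rightarrow> 'f::field"
  assumes "finite U" "finite D" "C \<subseteq> U" "D \<subseteq> U" "C \<inter> D = {}"
  shows "word_functional U g (set_word C D) = g C D"
  using assms(2,4,5)
proof (induction D arbitrary: g rule: finite_linorder_max_induct)
  case (insert m D)
  have m: "m \<in> U - (C \<union> D)" using insert by auto
  let ?X = "insert m (C \<union> D)"
  have ne: "set_word C D \<noteq> []" using set_word_Cons[of D C] insert by auto
  have "word_functional U g (set_word C (insert m D)) = act U ?X g C D"
    using insert ne by (simp add: set_word_insert_Max word_functional_Cons)
  also have "\<dots> = (\<Sum>l\<in>U - (C \<union> D). if l = m then insertion_sign m D * g C (insert m D) else 0)"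
    unfolding act_altdef
  proof (rule sum.cong[OF refl])
    fix l assume l: "l \<in> U - (C \<union> D)"
    have "C \<union> D \<noteq> ?X" "insert l (C \<union> D) = ?X \<longleftrightarrow> l = m" using m l by auto
    then show "insertion_sign l D * (of_bool (insert l (C \<union> D) = ?X) - of_bool (C \<union> D = ?X)) * g C (insert l D) =
      (if l = m then insertion_sign m D * g C (insert m D) else 0)" by simp
  qed
  also have "\<dots> = g C (insert m D)"
    using assms(1) m insert.hyps insertion_sign_Max[of D m, where 'a = 'f] by (simp add: sum.delta)
  finally show ?case .
qed simp

section \<open>Explicit balanced functions and their values on basis pairs\<close>

text \<open>The values of a balanced function that is supported on subsets of \<open>{..m}\<close> are forced once it takes the value
  \<open>\<delta>\<^sub>(\<^sub>C\<^sub>0\<^sub>,\<^sub>D\<^sub>0\<^sub>)\<close> at every \<open>(C \<union> {m}, D)\<close> with \<open>C\<close>, \<open>D\<close> below \<open>m\<close>.\<close>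

definition pivot_delta :: "nat set \<Rightarrow> nat set \<Rightarrow> nat set \<Rightarrow> nat set \<Rightarrow> 'f::field" where
  "pivot_delta C0 D0 C D = of_bool (C = C0 \<and> D = D0)"

definition pivot_functional ::
  "nat set \<Rightarrow> nat \<Rightarrow> nat set \<Rightarrow> nat set \<Rightarrow> nat set \<Rightarrow> nat set \<Rightarrow> 'f::field" where
  "pivot_functional U m C0 D0 C D =
    (if \<exists>x\<in>C \<union> D. m < x then 0
     else if m \<in> C then pivot_delta C0 D0 (C - {m}) D
     else if m \<in> D then up (U \<inter> {..<m}) (pivot_delta C0 D0) C (D - {m}) - down (pivot_delta C0 D0) C (D - {m})
     else - pivot_delta C0 D0 C D)"

text \<open>The three cases follow the position of \<open>m\<close>. For \<open>m\<close> in
  \<open>C\<close> the equation determines the value at the pair with \<open>m\<close> moved to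
  \<open>D\<close>; for \<open>m\<close> in neither set that value cancels against the negated
  delta; for \<open>m\<close> in \<open>D\<close> the rules for \<open>up\<close> and
  \<open>down\<close> make both sides equal.\<close>

lemma balanced_pivot_functional:
  assumes U: "finite U" and mU: "m \<in> U"
  shows "balanced U (pivot_functional U m C0 D0 :: nat set \<Rightarrow> nat set \<Rightarrow> 'f::field)"
  unfolding balanced_def
proof (intro allI impI)
  fix C D assume CD: "C \<subseteq> U" "D \<subseteq> U" "C \<inter> D = {}" "2 \<le> card C"
  let ?g = "pivot_functional U m C0 D0 :: nat set \<Rightarrow> nat set \<Rightarrow> 'f"
  let ?q = "pivot_delta C0 D0 :: nat set \<Rightarrow> nat set \<Rightarrow> 'f"
  let ?L = "U \<inter> {..<m}"
  have fin: "finite C" "finite D" "finite ?L" using CD U finite_subset by auto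
  show "down ?g C D = up U ?g C D"
  proof (cases "\<exists>x\<in>C \<union> D. m < x")
    case True
    have "up U ?g C D = 0"
      unfolding up_def by (rule sum.neutral) (use True in \<open>auto simp: pivot_functional_def\<close>)
    moreover have "down ?g C D = 0"
      unfolding down_def by (rule sum.neutral) (use True in \<open>auto simp: pivot_functional_def\<close>)
    ultimately show ?thesis by simp
  next
    case False
    have le: "x \<le> m" if "x \<in> C \<union> D" for x using False that not_less by blast
    \<comment> \<open>The function vanishes once an element above \<open>m\<close> occurs, so only
      insertions of \<open>m\<close> and of smaller elements count.\<close>
    have upU: "up U ?g C D = (\<Sum>l\<in>insert m ?L - (C \<union> D). insertion_sign l D * ?g C (insert l D))"
      unfolding up_def
      by (rule sum.mono_neutral_right)
        (use U mU in \<open>auto simp: pivot_functional_def\<close>)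
    consider (lower) "m \<notin> C" "m \<notin> D" | (inC) "m \<in> C" | (inD) "m \<in> D" "m \<notin> C" by blast
    then show ?thesis
    proof cases
      case lower
      have lt: "x < m" if "x \<in> C \<union> D" for x using le[OF that] lower that by (auto simp: less_le)
      have "down ?g C D = - down ?q C D"
        unfolding down_def sum_negf[symmetric]
        by (intro sum.cong refl) (use False lower in \<open>auto simp: pivot_functional_def\<close>)
      moreover have "up U ?g C D = insertion_sign m D * ?g C (insert m D) +
          (\<Sum>l\<in>?L - (C \<union> D). insertion_sign l D * ?g C (insert l D))"
      proof -
        have "insert m ?L - (C \<union> D) = insert m (?L - (C \<union> D))" using lower by auto
        then show ?thesis unfolding upU using fin by (simp add: sum.insert)
      qed
      moreover have "(\<Sum>l\<in>?L - (C \<union> D). insertion_sign l D * ?g C (insert l D)) = - up ?L ?q C D"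
        unfolding up_def sum_negf[symmetric]
        by (intro sum.cong refl) (use False lower in \<open>auto simp: pivot_functional_def\<close>)
      moreover have "insertion_sign m D = (1 :: 'f)" by (rule insertion_sign_Max) (use lt in auto)
      moreover have "?g C (insert m D) = up ?L ?q C D - down ?q C D"
        using False lower by (simp add: pivot_functional_def)
      ultimately show ?thesis by simp
    next
      case inC
      define C1 where "C1 = C - {m}"
      have C1: "C = insert m C1" "m \<notin> C1" "finite C1" using inC fin by (auto simp: C1_def)
      have mD: "m \<notin> D" using inC CD by auto
      have lt: "x < m" if "x \<in> D" for x using le[of x] that mD by (auto simp: less_le)
      have "insertion_sign m D = (1 :: 'f)" by (rule insertion_sign_Max) (rule lt)
      moreover have "?g C1 (insert m D) = up ?L ?q C1 D - down ?q C1 D"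
        using False mD C1 by (simp add: pivot_functional_def)
      moreover have "(\<Sum>i\<in>C1. insertion_sign i D * ?g (C - {i}) (insert i D)) = down ?q C1 D"
        unfolding down_def
      proof (rule sum.cong[OF refl])
        fix i assume i: "i \<in> C1"
        have "C - {i} - {m} = C1 - {i}" "m \<in> C - {i}" using i C1 by auto
        then show "insertion_sign i D * ?g (C - {i}) (insert i D) = insertion_sign i D * ?q (C1 - {i}) (insert i D)"
          using False i C1 by (auto simp: pivot_functional_def)
      qed
      moreover have "down ?g C D = insertion_sign m D * ?g C1 (insert m D) +
          (\<Sum>i\<in>C1. insertion_sign i D * ?g (C - {i}) (insert i D))"
        unfolding down_def by (subst C1(1), subst sum.insert) (use C1 in auto)
      moreover have "up U ?g C D = up ?L ?q C1 D"
      proof -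
        have "insert m ?L - (C \<union> D) = ?L - (C1 \<union> D)" using C1 by auto
        then show ?thesis unfolding upU unfolding up_def
          by (intro sum.cong) (use False C1 in \<open>auto simp: pivot_functional_def\<close>)
      qed
      ultimately show ?thesis by simp
    next
      case inD
      define D1 where "D1 = D - {m}"
      have D1: "D = insert m D1" "m \<notin> D1" "finite D1" using inD fin by (auto simp: D1_def)
      have lt: "x < m" if "x \<in> C \<union> D1" for x
        using le[of x] that inD by (auto simp: less_le D1_def)
      have disj: "C \<inter> D1 = {}" using CD D1 by auto
      \<comment> \<open>The largest element \<open>m\<close> of \<open>D\<close> lies above every
        other inserted element and contributes one sign change, the same on both sides of the
        equation.\<close>
      have sgn: "insertion_sign l D = - (insertion_sign l D1 :: 'f)" if "l < m" for l
        unfolding D1(1) by (rule insertion_sign_insert_greater) (use D1 that in auto)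
      have val: "?g C' (insert l D) = up ?L ?q C' (insert l D1) - down ?q C' (insert l D1)"
        if "C' \<subseteq> C" "l < m" for C' l
      proof -
        have "insert l D - {m} = insert l D1" using that D1 by auto
        then show ?thesis using False inD that by (auto simp: pivot_functional_def)
      qed
      have "down ?g C D = - down (\<lambda>C D. up ?L ?q C D - down ?q C D) C D1"
        unfolding down_def[of ?g] down_def[of "\<lambda>C D. up ?L ?q C D - down ?q C D"] sum_negf[symmetric]
        by (intro sum.cong refl) (use lt in \<open>simp add: sgn val\<close>)
      also have "\<dots> = - (down (up ?L ?q) C D1 - down (down ?q) C D1)"
        unfolding down_def[of "up ?L ?q"] down_def[of "down ?q"] down_def[of "\<lambda>C D. up ?L ?q C D - down ?q C D"]
        by (simp add: right_diff_distrib sum_subtractf)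
      also have "\<dots> = up ?L (down ?q) C D1"
        using down_down[of C D1 ?q] down_up[of D1 C ?L ?q] fin D1 disj by simp
      finally have 1: "down ?g C D = up ?L (down ?q) C D1" .
      have "insert m ?L - (C \<union> D) = ?L - (C \<union> D1)" using D1 by auto
      then have "up U ?g C D = - up ?L (\<lambda>C D. up ?L ?q C D - down ?q C D) C D1"
        unfolding upU up_def[of ?L "\<lambda>C D. up ?L ?q C D - down ?q C D"] sum_negf[symmetric]
        by (intro sum.cong) (simp_all add: sgn val)
      also have "\<dots> = - (up ?L (up ?L ?q) C D1 - up ?L (down ?q) C D1)"
        unfolding up_def[of ?L "up ?L ?q"] up_def[of ?L "down ?q"] up_def[of ?L "\<lambda>C D. up ?L ?q C D - down ?q C D"]
        by (simp add: right_diff_distrib sum_subtractf)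
      also have "\<dots> = up ?L (down ?q) C D1"
        using up_up[of ?L D1 ?q C] fin D1 by simp
      finally show ?thesis using 1 by simp
    qed
  qed
qed

text \<open>The pairs whose union has its maximum in \<open>C\<close>. The index \<open>k\<close>
  counts the removed elements, so the corresponding words have length \<open>k + 1\<close>.\<close>

definition basis_pairs :: "nat set \<Rightarrow> nat \<Rightarrow> (nat set \<times> nat set) set" where
  "basis_pairs U k = {(C, D). C \<noteq> {} \<and> C \<subseteq> U \<and> D \<subseteq> U \<and> C \<inter> D = {} \<and> card D = k \<and> (\<forall>d\<in>D. d < Max C)}"

lemma finite_basis_pairs: "finite U \<Longrightarrow> finite (basis_pairs U k)"
  by (rule finite_subset[of _ "Pow U \<times> Pow U"]) (auto simp: basis_pairs_def)

text \<open>Among basis pairs the values form a unitriangular matrix with respect to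
  \<open>card C\<close>. The branch with the pivot in \<open>D\<close> cannot occur: if nothing
  exceeds the pivot, then neither does \<open>Max C\<close>, and all of \<open>D\<close> lies
  strictly below that.\<close>

lemma pivot_functional_basis_pair:
  assumes U: "finite U" and CD: "(C, D) \<in> basis_pairs U k" and CD1: "(C1, D1) \<in> basis_pairs U k"
  shows "pivot_functional U (Max C1) (C1 - {Max C1}) D1 C D =
    of_bool ((C, D) = (C1, D1)) - (of_bool ((C, D) = (C1 - {Max C1}, D1)) :: 'f::field)"
proof -
  let ?m = "Max C1"
  have C: "finite C" "C \<noteq> {}" "\<And>d. d \<in> D \<Longrightarrow> d < Max C" and C1: "finite C1" "C1 \<noteq> {}"
    using CD CD1 U finite_subset by (auto simp: basis_pairs_def)
  have m: "?m \<in> C1" "\<And>x. x \<in> C1 \<Longrightarrow> x \<le> ?m" using C1 by auto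
  have M: "Max C \<in> C" "\<And>x. x \<in> C \<Longrightarrow> x \<le> Max C" using C by auto
  show ?thesis
  proof (cases "\<exists>x\<in>C \<union> D. ?m < x")
    case True
    then have "?m < Max C" using C(3) M(2) by fastforce
    then have "Max C \<in> C - C1" using M(1) m(2) by fastforce
    then have "C \<noteq> C1" "C \<noteq> C1 - {?m}" by auto
    then show ?thesis using True by (auto simp: pivot_functional_def)
  next
    case False
    then have "?m \<notin> D" using C(3) M(1) by fastforce
    moreover have "C - {?m} = C1 - {?m} \<longleftrightarrow> C = C1" if "?m \<in> C" using that m by auto
    ultimately show ?thesis
      using False m by (auto simp: pivot_functional_def pivot_delta_def)
  qed
qed

section \<open>Spanning\<close>

interpretation pm: vector_space pm_scale
  by (rule vector_space_pm_scale)

definition word_monomial :: "('a \<Rightarrow> 'b) \<Rightarrow> 'a list \<Rightarrow> 'b list \<Rightarrow>\<^sub>0 'f::field" where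
  "word_monomial x w = Poly_Mapping.single (map x w) 1"

definition left_mult :: "('a \<Rightarrow> 'b) \<Rightarrow> 'a \<Rightarrow> ('b list \<Rightarrow>\<^sub>0 'f::field) \<Rightarrow> 'b list \<Rightarrow>\<^sub>0 'f" where
  "left_mult x A p = Poly_Mapping.single [x A] 1 * p"

lemma left_mult_word_monomial [simp]:
  "left_mult x A (word_monomial x w) = word_monomial x (A # w)"
  by (simp add: left_mult_def word_monomial_def mult_single plus_list_def)

lemma left_mult_pm_scale: "left_mult x A (pm_scale c p) = pm_scale c (left_mult x A p)"
proof -
  have "Poly_Mapping.single [x A] 1 * Poly_Mapping.single [] c =
      Poly_Mapping.single [] c * Poly_Mapping.single [x A] 1"
    by (simp add: mult_single plus_list_def)
  then show ?thesis by (simp add: left_mult_def pm_scale_conv_times mult.assoc[symmetric])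
qed

lemma left_mult_add: "left_mult x A (p + q) = left_mult x A p + left_mult x A q"
  by (simp add: left_mult_def algebra_simps)

lemma left_mult_diff: "left_mult x A (p - q) = left_mult x A p - left_mult x A q"
  by (simp add: left_mult_def algebra_simps)

lemma left_mult_sum: "left_mult x A (sum f S) = (\<Sum>s\<in>S. left_mult x A (f s))"
  by (simp add: left_mult_def sum_distrib_left)

text \<open>The ideal contains the products of generators other than \<open>s(A)s(A)\<close> and
  \<open>s(A)s(A \<setminus> i)\<close>, the products \<open>\<sigma> s(A)\<close>, and the products \<open>s(A) \<sigma>\<close> with
  \<open>\<bar>A\<bar> \<ge> 2\<close>, where \<open>\<sigma>\<close> is the sum of all generators. These relations already suffice
  to reduce every word to basis words.\<close>

locale sigma_ideal =
  fixes U :: "nat set" and x :: "nat set \<Rightarrow> 'b" and I :: "('b list \<Rightarrow>\<^sub>0 'f::field) set"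
  assumes finite_U: "finite U"
    and I_subspace: "pm.subspace I"
    and I_left_mult: "\<And>p A. p \<in> I \<Longrightarrow> A \<in> nonempty_subsets U \<Longrightarrow> left_mult x A p \<in> I"
    and I_far: "\<And>A B w. A \<in> nonempty_subsets U \<Longrightarrow> B \<in> nonempty_subsets U \<Longrightarrow> A \<noteq> B \<Longrightarrow>
      (\<And>l. l \<notin> B \<Longrightarrow> A \<noteq> insert l B) \<Longrightarrow> set w \<subseteq> nonempty_subsets U \<Longrightarrow> word_monomial x (A # B # w) \<in> I"
    and I_sigma_left: "\<And>A w. A \<in> nonempty_subsets U \<Longrightarrow> set w \<subseteq> nonempty_subsets U \<Longrightarrow>
      (\<Sum>B\<in>nonempty_subsets U. word_monomial x (B # A # w)) \<in> I"
    and I_sigma_right: "\<And>A w. A \<in> nonempty_subsets U \<Longrightarrow> 2 \<le> card A \<Longrightarrow> set w \<subseteq> nonempty_subsets U \<Longrightarrow>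
      (\<Sum>B\<in>nonempty_subsets U. word_monomial x (A # B # w)) \<in> I"
begin

abbreviation "N \<equiv> nonempty_subsets U"
abbreviation lm :: "nat set \<Rightarrow> ('b list \<Rightarrow>\<^sub>0 'f) \<Rightarrow> 'b list \<Rightarrow>\<^sub>0 'f" where "lm \<equiv> left_mult x"
abbreviation W :: "nat set list \<Rightarrow> 'b list \<Rightarrow>\<^sub>0 'f" where "W \<equiv> word_monomial x"
abbreviation E :: "nat set \<Rightarrow> nat set \<Rightarrow> 'b list \<Rightarrow>\<^sub>0 'f" where "E C D \<equiv> word_monomial x (set_word C D)"
abbreviation sg :: "nat \<Rightarrow> nat set \<Rightarrow> 'f" where "sg \<equiv> insertion_sign"

section \<open>Rewriting a generator placed in front of a chain word\<close>

definition eqv (infix "\<approx>" 50) where "p \<approx> q \<longleftrightarrow> p - q \<in> I"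

lemmas I_closed = pm.subspace_add[OF I_subspace] pm.subspace_diff[OF I_subspace]
  pm.subspace_scale[OF I_subspace] pm.subspace_0[OF I_subspace] pm.subspace_sum[OF I_subspace]
  pm.subspace_neg[OF I_subspace]

lemma eqv_refl [simp]: "p \<approx> p"
  using I_closed by (simp add: eqv_def)

lemma eqv_sym: "p \<approx> q \<Longrightarrow> q \<approx> p"
  using I_closed(6)[of "p - q"] by (simp add: eqv_def)

lemma eqv_trans [trans]: "p \<approx> q \<Longrightarrow> q \<approx> r \<Longrightarrow> p \<approx> r"
  using I_closed(1)[of "p - q" "q - r"] by (simp add: eqv_def)

lemma eqv_0: "p \<approx> 0 \<longleftrightarrow> p \<in> I"
  by (simp add: eqv_def)

lemma eqv_scale: "p \<approx> q \<Longrightarrow> pm_scale c p \<approx> pm_scale c q"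
  using I_closed(3)[of "p - q" c] by (simp add: eqv_def pm.scale_right_diff_distrib)

lemma eqv_add: "p \<approx> q \<Longrightarrow> p' \<approx> q' \<Longrightarrow> p + p' \<approx> q + q'"
  using I_closed(1)[of "p - q" "p' - q'"] by (simp add: eqv_def algebra_simps)

lemma eqv_diff: "p \<approx> q \<Longrightarrow> p' \<approx> q' \<Longrightarrow> p - p' \<approx> q - q'"
  using I_closed(2)[of "p - q" "p' - q'"] by (simp add: eqv_def algebra_simps)

lemma eqv_uminus: "p \<approx> q \<Longrightarrow> - p \<approx> - q"
  using eqv_diff[of 0 0 p q] by simp

lemma eqv_sum: "(\<And>s. s \<in> S \<Longrightarrow> f s \<approx> g s) \<Longrightarrow> sum f S \<approx> sum g S"
  using I_closed(5)[of S "\<lambda>s. f s - g s"] by (simp add: eqv_def sum_subtractf)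

lemma eqv_lm: "p \<approx> q \<Longrightarrow> A \<in> N \<Longrightarrow> lm A p \<approx> lm A q"
  using I_left_mult[of "p - q" A] by (simp add: eqv_def left_mult_diff)

lemma eqv_sum_subset:
  assumes "finite S" "T \<subseteq> S" "\<And>s. s \<in> S - T \<Longrightarrow> f s \<approx> 0"
  shows "sum f S \<approx> sum f T"
proof -
  have "sum f S = sum f (S - T) + sum f T" by (rule sum.subset_diff) (use assms in auto)
  also have "\<dots> \<approx> sum (\<lambda>s. 0) (S - T) + sum f T"
    by (intro eqv_add eqv_sum) (use assms in auto)
  finally show ?thesis by simp
qed

definition admissible :: "nat set \<Rightarrow> nat set \<Rightarrow> bool" where
  "admissible C D \<longleftrightarrow> C \<noteq> {} \<and> C \<subseteq> U \<and> D \<subseteq> U \<and> C \<inter> D = {}"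

lemma admissibleD:
  assumes "admissible C D"
  shows "finite C" "finite D" "C \<in> N" "C \<union> D \<in> N" "set (set_word C D) \<subseteq> N"
proof -
  show "finite C" and D: "finite D" and C: "C \<in> N" and "C \<union> D \<in> N"
    using assms finite_U finite_subset by (auto simp: admissible_def nonempty_subsets_def)
  show "set (set_word C D) \<subseteq> N"
    by (rule set_set_word) (use C D assms in \<open>auto simp: admissible_def\<close>)
qed

lemma finite_N: "finite N"
  using finite_U by (rule finite_nonempty_subsets)

lemma far_left:
  assumes CD: "admissible C D" and B: "B \<in> N" "B \<noteq> C \<union> D" "\<And>l. l \<notin> C \<union> D \<Longrightarrow> B \<noteq> insert l (C \<union> D)"
  shows "lm B (E C D) \<approx> 0"
proof -
  obtain w where w: "set_word C D = (C \<union> D) # w" using set_word_Cons admissibleD[OF CD] by blast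
  then have "W (B # (C \<union> D) # w) \<in> I"
    using B admissibleD[OF CD] by (intro I_far) auto
  then show ?thesis by (simp add: eqv_0 w)
qed

text \<open>In the relation \<sigma> s(X) = 0 with X the first letter of the word, only the
  generators of X itself and of X enlarged by one element survive.\<close>

lemma same_left:
  assumes CD: "admissible C D"
  shows "lm (C \<union> D) (E C D) \<approx> - (\<Sum>l\<in>U - (C \<union> D). lm (insert l (C \<union> D)) (E C D))"
proof -
  let ?X = "C \<union> D"
  obtain w where w: "set_word C D = ?X # w" using set_word_Cons admissibleD[OF CD] by blast
  let ?T = "insert ?X ((\<lambda>l. insert l ?X) ` (U - ?X))"
  have "(\<Sum>B\<in>N. lm B (E C D)) \<approx> (\<Sum>B\<in>?T. lm B (E C D))"
  proof (rule eqv_sum_subset[OF finite_N])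
    show "?T \<subseteq> N" using CD by (auto simp: admissible_def nonempty_subsets_def)
    fix B assume "B \<in> N - ?T"
    then show "lm B (E C D) \<approx> 0"
      by (intro far_left[OF CD]) (auto simp: nonempty_subsets_def)
  qed
  moreover have "(\<Sum>B\<in>N. lm B (E C D)) \<approx> 0"
    using I_sigma_left[of ?X w] admissibleD[OF CD] w by (simp add: eqv_0)
  ultimately have 0: "(\<Sum>B\<in>?T. lm B (E C D)) \<approx> 0" using eqv_trans eqv_sym by blast
  have "(\<Sum>B\<in>?T. lm B (E C D)) = lm ?X (E C D) + (\<Sum>l\<in>U - ?X. lm (insert l ?X) (E C D))"
  proof -
    have "inj_on (\<lambda>l. insert l ?X) (U - ?X)" by (rule inj_onI) auto
    moreover have "?X \<notin> (\<lambda>l. insert l ?X) ` (U - ?X)" by auto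
    ultimately show ?thesis using finite_U by (simp add: sum.reindex)
  qed
  from 0[unfolded this] show ?thesis by (simp add: eqv_def)
qed

text \<open>In s(Z) \<sigma> E(C, D) only the two generators strictly between
  \<open>C \<union> D\<close> and \<open>Z\<close> survive: any other letter fails to fit either
  below \<open>Z\<close> or above \<open>C \<union> D\<close>. Hence the two removal orders of
  \<open>l\<close> and \<open>m\<close> anticommute.\<close>

lemma exchange_left:
  assumes CD: "admissible C D" and lm: "l \<in> U - (C \<union> D)" "m \<in> U - (C \<union> D)" "l \<noteq> m"
  defines "Z \<equiv> insert l (insert m (C \<union> D))"
  shows "lm Z (lm (insert m (C \<union> D)) (E C D)) \<approx> - lm Z (lm (insert l (C \<union> D)) (E C D))"
proof -
  let ?X = "C \<union> D"
  obtain w where w: "set_word C D = ?X # w" using set_word_Cons admissibleD[OF CD] by blast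
  have Z: "Z \<in> N" using lm CD by (auto simp: Z_def admissible_def nonempty_subsets_def)
  have XN: "insert k ?X \<in> N" if "k \<in> U" for k using that CD by (auto simp: admissible_def nonempty_subsets_def)
  have fX: "finite ?X" using admissibleD[OF CD] by auto
  have "card Z = Suc (Suc (card ?X))" using lm fX by (simp add: Z_def)
  then have "2 \<le> card Z" by simp
  then have 0: "(\<Sum>B\<in>N. lm Z (lm B (E C D))) \<approx> 0"
    using I_sigma_right[of Z "set_word C D"] admissibleD[OF CD] Z by (simp add: eqv_0)
  have "(\<Sum>B\<in>N. lm Z (lm B (E C D))) \<approx> (\<Sum>B\<in>{insert m ?X, insert l ?X}. lm Z (lm B (E C D)))"
  proof (rule eqv_sum_subset[OF finite_N])
    show "{insert m ?X, insert l ?X} \<subseteq> N" using XN lm by auto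
    fix B assume B: "B \<in> N - {insert m ?X, insert l ?X}"
    show "lm Z (lm B (E C D)) \<approx> 0"
    proof (cases "B = ?X \<or> (\<exists>k. k \<notin> ?X \<and> B = insert k ?X)")
      case True
      have "B \<noteq> Z" "\<And>j. Z \<noteq> insert j B"
      proof -
        from True have "B = ?X \<or> (\<exists>k. k \<notin> ?X \<and> k \<noteq> l \<and> k \<noteq> m \<and> B = insert k ?X)" using B by auto
        then have "l \<notin> B" "m \<notin> B" using lm by auto
        then show "B \<noteq> Z" by (auto simp: Z_def)
        show "Z \<noteq> insert j B" for j
        proof
          assume "Z = insert j B"
          then have "l \<in> insert j B" "m \<in> insert j B" by (auto simp: Z_def)
          then show False using \<open>l \<notin> B\<close> \<open>m \<notin> B\<close> lm(3) by auto
        qed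
      qed
      then have "W (Z # B # set_word C D) \<in> I"
        using B Z admissibleD[OF CD] by (intro I_far) auto
      then show ?thesis by (simp add: eqv_0)
    next
      case False
      then have "lm B (E C D) \<approx> 0" using B by (intro far_left[OF CD]) auto
      then show ?thesis using eqv_lm[OF _ Z] by (fastforce simp: left_mult_def)
    qed
  qed
  then have "(\<Sum>B\<in>{insert m ?X, insert l ?X}. lm Z (lm B (E C D))) \<approx> 0"
    using 0 eqv_trans eqv_sym by blast
  moreover have "insert m ?X \<noteq> insert l ?X" using lm by auto
  ultimately show ?thesis by (simp add: eqv_def)
qed

text \<open>The new element \<open>l\<close> is moved to its place in the decreasing removal order.
  Each larger element of \<open>D\<close> is passed by one exchange, and these exchanges produce the
  insertion sign.\<close>

lemma insert_left:
  assumes "admissible C D" "l \<in> U - (C \<union> D)"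
  shows "lm (insert l (C \<union> D)) (E C D) \<approx> pm_scale (sg l D) (E C (insert l D))"
proof -
  have "finite D" using admissibleD assms by blast
  then show ?thesis using assms
  proof (induction D rule: finite_linorder_max_induct)
    case empty
    have "set_word C {l} = insert l C # set_word C {}"
      using set_word_insert_Max[of "{}" l C] by simp
    then show ?case by simp
  next
    case (insert m D)
    let ?X = "C \<union> D"
    have adm: "admissible C D" and m: "m \<in> U - ?X" and lX: "l \<in> U - ?X" "l \<noteq> m"
      using insert by (auto simp: admissible_def)
    let ?Z = "insert l (insert m ?X)"
    have Z: "?Z \<in> N" using m lX adm by (auto simp: admissible_def nonempty_subsets_def)
    have Em: "E C (insert m D) = lm (insert m ?X) (E C D)"
      using set_word_insert_Max[of D m C] insert.hyps by simp
    show ?case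
    proof (cases "l < m")
      case True
      have "set_word C (insert m (insert l D)) = ?Z # set_word C (insert l D)"
        using set_word_insert_Max[of "insert l D" m C] insert.hyps True by (auto simp: insert_commute)
      then have Elm: "lm ?Z (E C (insert l D)) = E C (insert l (insert m D))"
        by (simp add: insert_commute)
      have "lm (insert l (C \<union> insert m D)) (E C (insert m D)) = lm ?Z (lm (insert m ?X) (E C D))"
        by (simp add: Em)
      also have "\<dots> \<approx> - lm ?Z (lm (insert l ?X) (E C D))"
        by (rule exchange_left[OF adm lX(1) m lX(2)])
      also have "\<dots> \<approx> - lm ?Z (pm_scale (sg l D) (E C (insert l D)))"
        by (intro eqv_uminus eqv_lm Z insert.IH adm lX)
      also have "\<dots> = - pm_scale (sg l D) (E C (insert l (insert m D)))"
        by (simp only: left_mult_pm_scale Elm)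
      also have "\<dots> = pm_scale (- sg l D) (E C (insert l (insert m D)))"
        by (simp add: pm.scale_minus_left)
      also have "- sg l D = sg l (insert m D)"
        using insertion_sign_insert_greater[of l m D, where 'a = 'f] True insert.hyps by auto
      finally show ?thesis .
    next
      case False
      then have "m < l" using lX by auto
      then have gt: "d < l" if "d \<in> insert m D" for d using that insert.hyps by fastforce
      have "sg l (insert m D) = 1" by (rule insertion_sign_Max) (rule gt)
      moreover have "set_word C (insert l (insert m D)) = ?Z # set_word C (insert m D)"
        using set_word_insert_Max[of "insert m D" l C] insert.hyps gt by simp
      ultimately show ?thesis by simp
    qed
  qed
qed

lemma union_left:
  assumes "admissible C D"
  shows "lm (C \<union> D) (E C D) \<approx> - (\<Sum>l\<in>U - (C \<union> D). pm_scale (sg l D) (E C (insert l D)))"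
  by (rule eqv_trans[OF same_left[OF assms]]) (intro eqv_uminus eqv_sum insert_left assms)

section \<open>The linear relations among the chain words\<close>

definition column_relation :: "nat set \<Rightarrow> nat set \<Rightarrow> 'b list \<Rightarrow>\<^sub>0 'f" where
  "column_relation C D = (\<Sum>i\<in>C. pm_scale (sg i D) (E (C - {i}) (insert i D)))
     - (\<Sum>l\<in>U - (C \<union> D). pm_scale (sg l D) (E C (insert l D)))"

text \<open>This is s(C) \<sigma> = 0. The surviving terms are s(C)s(C \<setminus> i), which are
  chain words, and s(C)s(C), which \<open>union_left\<close> rewrites.\<close>

lemma column_relation_empty:
  assumes C: "admissible C {}" "2 \<le> card C"
  shows "column_relation C {} \<approx> 0"
proof -
  have CN: "C \<in> N" "finite C" "C \<subseteq> U" using admissibleD[OF C(1)] C by (auto simp: admissible_def)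
  have ne: "C - {i} \<noteq> {}" for i
  proof
    assume "C - {i} = {}"
    then have "C \<subseteq> {i}" by auto
    then have "card C \<le> 1" using card_mono[of "{i}" C] by simp
    then show False using C by simp
  qed
  let ?T = "insert C ((\<lambda>i. C - {i}) ` C)"
  have "(\<Sum>B\<in>N. W [C, B]) \<approx> (\<Sum>B\<in>?T. W [C, B])"
  proof (rule eqv_sum_subset[OF finite_N])
    show "?T \<subseteq> N" using CN ne by (auto simp: nonempty_subsets_def)
    fix B assume B: "B \<in> N - ?T"
    have "C \<noteq> insert l B" if "l \<notin> B" for l
    proof
      assume "C = insert l B"
      then have "l \<in> C" "B = C - {l}" using that by auto
      then show False using B by auto
    qed
    then have "W [C, B] \<in> I" using B CN by (intro I_far) auto
    then show "W [C, B] \<approx> 0" by (simp add: eqv_0)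
  qed
  moreover have "(\<Sum>B\<in>N. W [C, B]) \<approx> 0" using I_sigma_right[of C "[]"] CN C by (simp add: eqv_0)
  ultimately have 0: "(\<Sum>B\<in>?T. W [C, B]) \<approx> 0" using eqv_trans eqv_sym by blast
  have "(\<Sum>B\<in>?T. W [C, B]) = lm C (E C {}) + (\<Sum>i\<in>C. E (C - {i}) {i})"
  proof -
    have "inj_on (\<lambda>i. C - {i}) C" by (rule inj_onI) auto
    moreover have "C \<notin> (\<lambda>i. C - {i}) ` C" by auto
    moreover have "set_word (C - {i}) {i} = [C, C - {i}]" if "i \<in> C" for i
    proof -
      have "insert i (C - {i}) = C" using that by auto
      then show ?thesis using set_word_insert_Max[of "{}" i "C - {i}"] by simp
    qed
    ultimately show ?thesis using CN by (simp add: sum.reindex)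
  qed
  note 0[unfolded this]
  moreover have "lm C (E C {}) \<approx> - (\<Sum>l\<in>U - C. E C {l})"
    using union_left[OF C(1)] by simp
  ultimately have "(lm C (E C {}) + (\<Sum>i\<in>C. E (C - {i}) {i})) - lm C (E C {}) \<approx> 0 - (- (\<Sum>l\<in>U - C. E C {l}))"
    by (rule eqv_diff)
  then show ?thesis by (simp add: column_relation_def eqv_def)
qed

text \<open>Left multiplication by the generator of \<open>C \<union> D\<close> enlarged by
  \<open>m\<close> carries the relation for \<open>D\<close>, up to a sign, to the relation for
  \<open>insert m D\<close>.\<close>

lemma column_relation_insert:
  assumes C: "admissible C D" and m: "m \<in> U - (C \<union> D)"
    and card: "2 \<le> card C" and D: "column_relation C D \<approx> 0"
  shows "column_relation C (insert m D) \<approx> 0"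
proof -
  let ?X = "C \<union> D" let ?Z = "insert m ?X"
  have Z: "?Z \<in> N" using m C by (auto simp: admissible_def nonempty_subsets_def)
  have fin: "finite D" using admissibleD[OF C] by auto
  have adm: "admissible (C - {i}) (insert i D)" if "i \<in> C" for i
  proof -
    have "C - {i} \<noteq> {}"
    proof
      assume "C - {i} = {}"
      then have "C \<subseteq> {i}" by auto
      then have "card C \<le> 1" using card_mono[of "{i}" C] by simp
      then show False using card by simp
    qed
    then show ?thesis using that C by (auto simp: admissible_def)
  qed
  have 1: "lm ?Z (pm_scale (sg i D) (E (C - {i}) (insert i D))) \<approx>
      - pm_scale (sg m D) (pm_scale (sg i (insert m D)) (E (C - {i}) (insert i (insert m D))))"
    if i: "i \<in> C" for i
  proof -
    have X: "C - {i} \<union> insert i D = ?X" using i by auto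
    have "lm ?Z (E (C - {i}) (insert i D)) \<approx>
        pm_scale (sg m (insert i D)) (E (C - {i}) (insert m (insert i D)))"
      using insert_left[OF adm[OF i], of m] m unfolding X by simp
    then have "pm_scale (sg i D) (lm ?Z (E (C - {i}) (insert i D))) \<approx>
        pm_scale (sg i D) (pm_scale (sg m (insert i D)) (E (C - {i}) (insert m (insert i D))))"
      by (rule eqv_scale)
    moreover have "sg i D * sg m (insert i D) = - (sg m D * sg i (insert m D))"
      by (rule insertion_sign_swap) (use i m C fin in \<open>auto simp: admissible_def\<close>)
    ultimately show ?thesis by (simp add: left_mult_pm_scale insert_commute)
  qed
  \<comment> \<open>Only \<open>l = m\<close> survives: for other \<open>l\<close> the first letter
    of the word contains \<open>l\<close>, which \<open>?Z\<close> lacks. For \<open>l = m\<close>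
    the new letter repeats the first one, and \<open>union_left\<close> yields the second sum of the
    new relation.\<close>
  have 2: "lm ?Z (pm_scale (sg l D) (E C (insert l D))) \<approx>
      (if l = m then - pm_scale (sg m D) (\<Sum>k\<in>U - (C \<union> insert m D). pm_scale (sg k (insert m D)) (E C (insert k (insert m D)))) else 0)"
    if l: "l \<in> U - ?X" for l
  proof (cases "l = m")
    case True
    have am: "admissible C (insert m D)" using C m by (auto simp: admissible_def)
    have "pm_scale (sg m D) (lm ?Z (E C (insert m D))) \<approx> pm_scale (sg m D)
      (- (\<Sum>k\<in>U - (C \<union> insert m D). pm_scale (sg k (insert m D)) (E C (insert k (insert m D)))))"
      using union_left[OF am] by (intro eqv_scale) simp
    then show ?thesis using True by (simp add: left_mult_pm_scale)
  next
    case False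
    have al: "admissible C (insert l D)" using C l by (auto simp: admissible_def)
    have "lm ?Z (E C (insert l D)) \<approx> 0"
    proof (rule far_left[OF al Z])
      have "l \<notin> ?Z" using l False by auto
      then show "?Z \<noteq> C \<union> insert l D" and "\<And>k. ?Z \<noteq> insert k (C \<union> insert l D)" by auto
    qed
    then have "pm_scale (sg l D) (lm ?Z (E C (insert l D))) \<approx> pm_scale (sg l D) 0" by (rule eqv_scale)
    then show ?thesis using False by (simp add: left_mult_pm_scale)
  qed
  have fU: "finite (U - ?X)" using finite_U by auto
  have "0 = lm ?Z 0" by (simp add: left_mult_def)
  also have "\<dots> \<approx> lm ?Z (column_relation C D)" by (rule eqv_lm[OF eqv_sym[OF D] Z])
  also have "\<dots> = (\<Sum>i\<in>C. lm ?Z (pm_scale (sg i D) (E (C - {i}) (insert i D))))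
      - (\<Sum>l\<in>U - ?X. lm ?Z (pm_scale (sg l D) (E C (insert l D))))"
    by (simp add: column_relation_def left_mult_diff left_mult_sum)
  also have "\<dots> \<approx> (\<Sum>i\<in>C. - pm_scale (sg m D) (pm_scale (sg i (insert m D)) (E (C - {i}) (insert i (insert m D)))))
      - (\<Sum>l\<in>U - ?X. if l = m then - pm_scale (sg m D) (\<Sum>k\<in>U - (C \<union> insert m D). pm_scale (sg k (insert m D)) (E C (insert k (insert m D)))) else 0)"
    by (intro eqv_diff eqv_sum 1 2)
  also have "\<dots> = - pm_scale (sg m D) (column_relation C (insert m D))"
    using m fU by (simp only: sum.delta if_True)
      (simp add: column_relation_def pm.scale_right_diff_distrib pm.scale_sum_right sum_negf)
  finally have "- pm_scale (sg m D) (column_relation C (insert m D)) \<approx> 0" by (rule eqv_sym)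
  \<comment> \<open>Multiplying by the sign once more removes it, since its square is
    \<open>1\<close>.\<close>
  from eqv_scale[OF this, of "sg m D"] have "- column_relation C (insert m D) \<approx> 0" by (simp add: pm.scale_minus_right)
  from eqv_uminus[OF this] show ?thesis by simp
qed

lemma column_relation_eqv_0:
  assumes "admissible C D" "2 \<le> card C"
  shows "column_relation C D \<approx> 0"
proof -
  have "finite D" using admissibleD assms by blast
  then show ?thesis using assms(1)
  proof (induction D rule: finite_induct)
    case empty
    then show ?case by (rule column_relation_empty) (rule assms)
  next
    case (insert m D)
    show ?case
      by (rule column_relation_insert)
        (use insert assms in \<open>auto simp: admissible_def\<close>)
  qed
qed

section \<open>Reduction of all words to basis words modulo the ideal\<close>

definition pair_span :: "nat \<Rightarrow> ('b list \<Rightarrow>\<^sub>0 'f) set" where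
  "pair_span k = pm.span (I \<union> {E C D | C D. admissible C D \<and> card D = k})"

definition basis_span :: "nat \<Rightarrow> ('b list \<Rightarrow>\<^sub>0 'f) set" where
  "basis_span k = pm.span (I \<union> (\<lambda>(C, D). E C D) ` basis_pairs U k)"

lemma span_eqv:
  assumes "p \<approx> q" "q \<in> pm.span (I \<union> S)"
  shows "p \<in> pm.span (I \<union> S)"
proof -
  have "p - q \<in> pm.span (I \<union> S)" using assms by (intro pm.span_base) (auto simp: eqv_def)
  from pm.span_add[OF this assms(2)] show ?thesis by simp
qed

lemma pair_span_base: "admissible C D \<Longrightarrow> card D = k \<Longrightarrow> E C D \<in> pair_span k"
  unfolding pair_span_def by (rule pm.span_base) blast

lemma pair_span_eqv: "p \<approx> q \<Longrightarrow> q \<in> pair_span k \<Longrightarrow> p \<in> pair_span k"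
  unfolding pair_span_def by (rule span_eqv)

lemma pair_span_subspace: "pm.subspace (pair_span k)"
  unfolding pair_span_def by (rule pm.subspace_span)

lemmas pair_span_closed = pm.subspace_scale[OF pair_span_subspace] pm.subspace_sum[OF pair_span_subspace]
  pm.subspace_neg[OF pair_span_subspace] pm.subspace_0[OF pair_span_subspace] pm.subspace_add[OF pair_span_subspace]

text \<open>A letter in front of \<open>E C D\<close> equals \<open>C \<union> D\<close>, exceeds it
  by one element, or is far from it; there is one rewriting rule for each case.\<close>

lemma lm_pair_span:
  assumes B: "B \<in> N" and p: "p \<in> pair_span k"
  shows "lm B p \<in> pair_span (Suc k)"
  using p unfolding pair_span_def[of k]
proof (induction rule: pm.span_induct_alt)
  case base
  then show ?case using pair_span_closed(4) by (simp add: left_mult_def)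
next
  case (step c p q)
  have "lm B p \<in> pair_span (Suc k)"
  proof (cases "p \<in> I")
    case True
    then have "lm B p \<approx> 0" using B I_left_mult by (simp add: eqv_0)
    then show ?thesis using pair_span_eqv pair_span_closed(4) by blast
  next
    case False
    then obtain C D where p: "p = E C D" and CD: "admissible C D" "card D = k" using step by auto
    let ?X = "C \<union> D"
    have fin: "finite D" using admissibleD[OF CD(1)] by auto
    have ins: "pm_scale c (E C (insert l D)) \<in> pair_span (Suc k)" if "l \<in> U - ?X" for l c
      using that CD fin by (intro pair_span_closed pair_span_base) (auto simp: admissible_def)
    consider "B = ?X" | l where "l \<notin> ?X" "B = insert l ?X" | "B \<noteq> ?X" "\<And>l. l \<notin> ?X \<Longrightarrow> B \<noteq> insert l ?X"
      by blast
    then show ?thesis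
    proof cases
      case 1
      show ?thesis unfolding p 1
        by (rule pair_span_eqv[OF union_left[OF CD(1)]]) (intro pair_span_closed(2,3) ins)
    next
      case 2
      then have l: "l \<in> U - ?X" using B by (auto simp: nonempty_subsets_def)
      show ?thesis unfolding p 2
        by (rule pair_span_eqv[OF insert_left[OF CD(1) l]]) (rule ins[OF l])
    next
      case 3
      have "lm B (E C D) \<approx> 0" by (rule far_left[OF CD(1) B]) (use 3 in auto)
      then show ?thesis unfolding p using pair_span_eqv pair_span_closed(4) by blast
    qed
  qed
  then show ?case using step pair_span_closed by (simp add: left_mult_add left_mult_pm_scale)
qed

lemma word_in_pair_span:
  assumes "set w \<subseteq> N" "length w = Suc k"
  shows "W w \<in> pair_span k"
  using assms
proof (induction w arbitrary: k)
  case (Cons B w)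
  show ?case
  proof (cases w)
    case Nil
    then have "E B {} \<in> pair_span k"
      using Cons by (intro pair_span_base) (auto simp: admissible_def nonempty_subsets_def)
    then show ?thesis using Nil by simp
  next
    case (Cons A v)
    then obtain j where j: "k = Suc j" using Cons.prems by (cases k) auto
    have "lm B (W w) \<in> pair_span (Suc j)"
      by (rule lm_pair_span) (use Cons.prems Cons.IH[of j] j in auto)
    then show ?thesis using j by simp
  qed
qed simp

text \<open>If the maximum \<open>m\<close> lies in \<open>D\<close>, the relation at
  \<open>insert m C\<close> and \<open>D - {m}\<close> is solved for its term with
  \<open>i = m\<close>, which is \<open>E C D\<close>. The other terms keep \<open>m\<close> in the
  first component, so they are basis words unless an element above \<open>m\<close> was inserted;
  then the maximum has risen and the induction applies.\<close>

lemma pair_in_basis_span: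
  assumes "admissible C D" "card D = k"
  shows "E C D \<in> basis_span k"
  using assms
proof (induction "card {u \<in> U. Max (C \<union> D) < u}" arbitrary: C D rule: less_induct)
  case less
  have base: "E C D \<in> basis_span k" if "admissible C D" "card D = k" "\<And>d. d \<in> D \<Longrightarrow> d < Max C" for C D
    unfolding basis_span_def
    by (rule pm.span_base) (use that in \<open>force simp: basis_pairs_def admissible_def\<close>)
  have sub: "pm.subspace (basis_span k)" unfolding basis_span_def by (rule pm.subspace_span)
  note fin = admissibleD[OF less.prems(1)]
  let ?m = "Max (C \<union> D)"
  have ne: "C \<union> D \<noteq> {}" using less.prems by (auto simp: admissible_def)
  have m: "?m \<in> C \<union> D" and le: "\<And>a. a \<in> C \<union> D \<Longrightarrow> a \<le> ?m"
    using fin ne Max_in[of "C \<union> D"] Max_ge[of "C \<union> D"] by blast+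
  show ?case
  proof (cases "?m \<in> C")
    case True
    have "Max C = ?m" by (rule Max_eqI) (use fin le True in auto)
    moreover have "d < ?m" if "d \<in> D" for d
    proof -
      have "d \<noteq> ?m" using that True less.prems by (auto simp: admissible_def)
      then show ?thesis using le[of d] that by simp
    qed
    ultimately show ?thesis using base less.prems by simp
  next
    case False
    define m where "m = ?m"
    define D1 where "D1 = D - {m}"
    have mD: "m \<in> D" "m \<notin> C" using m False by (auto simp: m_def)
    have D1: "D = insert m D1" "m \<notin> D1" "finite D1" using mD fin by (auto simp: D1_def)
    have lt: "a < m" if "a \<in> C \<union> D1" for a
    proof -
      have "a \<le> m" unfolding m_def by (rule le) (use that in \<open>auto simp: D1_def\<close>)
      moreover have "a \<noteq> m" using that mD D1 by auto
      ultimately show ?thesis by simp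
    qed
    let ?C = "insert m C"
    have adm: "admissible ?C D1" using less.prems D1 by (auto simp: admissible_def)
    have k: "card (insert i D1) = k" if "i \<notin> D1" for i using less.prems D1 that by simp
    have cC: "2 \<le> card ?C"
    proof -
      have "0 < card C" using fin less.prems by (auto simp: admissible_def card_gt_0_iff)
      then show ?thesis using fin mD by simp
    qed
    have Max_m: "Max (insert m A) = m" if "A \<subseteq> C \<union> D1" for A
      by (rule Max_eqI) (use that lt fin D1 finite_subset[of A "C \<union> D1"] in \<open>auto intro: less_imp_le\<close>)
    have 1: "pm_scale (sg i D1) (E (?C - {i}) (insert i D1)) \<in> basis_span k" if i: "i \<in> C" for i
    proof (intro pm.subspace_scale[OF sub] base)
      have "i \<noteq> m" using i mD by auto
      then have eq: "?C - {i} = insert m (C - {i})" by auto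
      show "admissible (?C - {i}) (insert i D1)"
        using less.prems i \<open>i \<noteq> m\<close> D1 by (auto simp: admissible_def)
      show "card (insert i D1) = k" using i less.prems D1 by (intro k) (auto simp: admissible_def)
      fix d assume "d \<in> insert i D1"
      then have "d < m" using lt i by auto
      moreover have "Max (insert m (C - {i})) = m" by (rule Max_m) auto
      ultimately show "d < Max (?C - {i})" unfolding eq by simp
    qed
    have 2: "pm_scale (sg l D1) (E ?C (insert l D1)) \<in> basis_span k" if l: "l \<in> U - (?C \<union> D1)" for l
    proof (rule pm.subspace_scale[OF sub])
      have al: "admissible ?C (insert l D1)" using adm l by (auto simp: admissible_def)
      have cl: "card (insert l D1) = k" by (rule k) (use l in auto)
      show "E ?C (insert l D1) \<in> basis_span k"
      proof (cases "l < m")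
        case True
        have "Max ?C = m" by (rule Max_m) auto
        then have "d < Max ?C" if "d \<in> insert l D1" for d
          using that True lt by auto
        then show ?thesis using base al cl by blast
      next
        case False
        then have ml: "m < l" using l by auto
        have "Max (?C \<union> insert l D1) = l"
          by (rule Max_eqI) (use ml lt fin D1 in \<open>auto intro: less_imp_le less_trans\<close>)
        moreover have "{u \<in> U. l < u} \<subset> {u \<in> U. m < u}" using ml l by auto
        ultimately have "card {u \<in> U. Max (?C \<union> insert l D1) < u} < card {u \<in> U. ?m < u}"
          using finite_U by (auto simp: m_def[symmetric] intro!: psubset_card_mono)
        then show ?thesis using less.hyps al cl by blast
      qed
    qed
    have "sg m D1 = 1" by (rule insertion_sign_Max) (use lt in auto)
    then have "(\<Sum>i\<in>?C. pm_scale (sg i D1) (E (?C - {i}) (insert i D1))) =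
        E C D + (\<Sum>i\<in>C. pm_scale (sg i D1) (E (?C - {i}) (insert i D1)))"
      using fin mD D1 by simp
    then have "E C D \<approx> (\<Sum>l\<in>U - (?C \<union> D1). pm_scale (sg l D1) (E ?C (insert l D1)))
        - (\<Sum>i\<in>C. pm_scale (sg i D1) (E (?C - {i}) (insert i D1)))"
      using column_relation_eqv_0[OF adm cC] by (simp add: column_relation_def eqv_def algebra_simps)
    moreover have "(\<Sum>l\<in>U - (?C \<union> D1). pm_scale (sg l D1) (E ?C (insert l D1)))
        - (\<Sum>i\<in>C. pm_scale (sg i D1) (E (?C - {i}) (insert i D1))) \<in> basis_span k"
      by (intro pm.subspace_diff[OF sub] pm.subspace_sum[OF sub] 1 2)
    ultimately show ?thesis unfolding basis_span_def by (rule span_eqv)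
  qed
qed

lemma word_in_basis_span:
  assumes "set w \<subseteq> N" "length w = Suc k"
  shows "W w \<in> basis_span k"
proof -
  have "pair_span k \<subseteq> basis_span k"
    unfolding pair_span_def
  proof (rule pm.span_minimal)
    show "I \<union> {E C D |C D. admissible C D \<and> card D = k} \<subseteq> basis_span k"
      using pair_in_basis_span by (auto simp: basis_span_def intro: pm.span_base)
  qed (simp add: basis_span_def)
  then show ?thesis using word_in_pair_span[OF assms] by blast
qed

lemma basis_span_expansion:
  assumes "p \<in> basis_span k"
  shows "\<exists>c. p - (\<Sum>b\<in>basis_pairs U k. pm_scale (c b) (case b of (C, D) \<Rightarrow> E C D)) \<in> I"
  using assms unfolding basis_span_def
proof (induction rule: pm.span_induct_alt)
  case base
  then show ?case using I_closed(4) by (intro exI[of _ "\<lambda>_. 0"]) simp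
next
  case (step a p q)
  let ?e = "\<lambda>b. case b of (C, D) \<Rightarrow> E C D"
  let ?S = "basis_pairs U k"
  have fin: "finite ?S" using finite_U by (rule finite_basis_pairs)
  have "\<exists>c. p - (\<Sum>b\<in>?S. pm_scale (c b) (?e b)) \<in> I"
  proof (cases "p \<in> I")
    case True
    then show ?thesis by (intro exI[of _ "\<lambda>_. 0"]) simp
  next
    case False
    then obtain b where b: "b \<in> ?S" "p = ?e b" using step by auto
    have "(\<Sum>b'\<in>?S. pm_scale (of_bool (b' = b)) (?e b')) = (\<Sum>b'\<in>?S. if b' = b then ?e b' else 0)"
      by (rule sum.cong) auto
    also have "\<dots> = ?e b" using b(1) fin by (simp add: sum.delta)
    finally have "p - (\<Sum>b'\<in>?S. pm_scale (of_bool (b' = b)) (?e b')) = 0" using b(2) by (simp only: diff_self)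
    then show ?thesis using I_closed(4) by (intro exI[of _ "\<lambda>b'. of_bool (b' = b)"]) (simp only:)
  qed
  then obtain c where c: "p - (\<Sum>b\<in>?S. pm_scale (c b) (?e b)) \<in> I" by blast
  obtain d where d: "q - (\<Sum>b\<in>?S. pm_scale (d b) (?e b)) \<in> I" using step by blast
  have "pm_scale a (p - (\<Sum>b\<in>?S. pm_scale (c b) (?e b))) + (q - (\<Sum>b\<in>?S. pm_scale (d b) (?e b))) \<in> I"
    by (intro I_closed(1,3) c d)
  also have "pm_scale a (p - (\<Sum>b\<in>?S. pm_scale (c b) (?e b))) + (q - (\<Sum>b\<in>?S. pm_scale (d b) (?e b))) =
      pm_scale a p + q - (\<Sum>b\<in>?S. pm_scale (a * c b + d b) (?e b))"
    by (simp add: pm.scale_right_diff_distrib pm.scale_sum_right pm.scale_left_distrib sum.distrib)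
  finally show ?case by (intro exI[of _ "\<lambda>b. a * c b + d b"])
qed

end

section \<open>The quadratic dual\<close>

lemma index_sets_eq: "index_sets n = nonempty_subsets {1..n}"
  by (auto simp: index_sets_def nonempty_subsets_def)

lemma inj_on_dual_vec: "inj_on (dual_vec n :: nat set \<Rightarrow> (nat set \<Rightarrow>\<^sub>0 'f::field) \<Rightarrow> 'f) (index_sets n)"
proof (rule inj_onI)
  fix A B assume A: "A \<in> index_sets n" and B: "B \<in> index_sets n"
    and eq: "(dual_vec n A :: (nat set \<Rightarrow>\<^sub>0 'f) \<Rightarrow> 'f) = dual_vec n B"
  have "(if B = A then 1 else 0 :: 'f) = 1"
    using dual_vec_basis_vec[OF A A, where 'a = 'f] dual_vec_basis_vec[OF B A, where 'a = 'f] fun_cong[OF eq, of "basis_vec A"] by simp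
  then show "A = B" by (simp split: if_splits)
qed

lemma inv_dual_vec_in:
  "b \<in> dual_basis n \<Longrightarrow> inv_into (index_sets n) (dual_vec n) b \<in> nonempty_subsets {1..n}"
  unfolding dual_basis_def index_sets_eq[symmetric] by (rule inv_into_into)

section \<open>The annihilator of the relations in coordinates\<close>

definition perp_coeffs :: "nat \<Rightarrow> 'f::field dual_tensor \<Rightarrow> nat set \<Rightarrow> nat set \<Rightarrow> 'f" where
  "perp_coeffs n r A B = (if A \<in> index_sets n \<and> B \<in> index_sets n
     then Poly_Mapping.lookup r [dual_vec n A, dual_vec n B] else 0)"

lemma word_eval_tensor_power_2:
  fixes r :: "'f::field dual_tensor"
  assumes r: "r \<in> tensor_power (dual_basis n) 2"
  shows "word_eval f r = (\<Sum>A\<in>index_sets n. \<Sum>B\<in>index_sets n.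
    perp_coeffs n r A B * f [dual_vec n A, dual_vec n B])"
proof -
  let ?h = "\<lambda>(A, B). [dual_vec n A, dual_vec n B] :: ((nat set \<Rightarrow>\<^sub>0 'f) \<Rightarrow> 'f) list"
  let ?P = "index_sets n \<times> index_sets n"
  have "Poly_Mapping.keys r \<subseteq> ?h ` ?P"
  proof
    fix w assume "w \<in> Poly_Mapping.keys r"
    then have w: "w \<in> lists (dual_basis n)" "length w = 2" using r by (auto simp: tensor_power_def)
    then obtain a b where "w = [a, b]" "a \<in> dual_basis n" "b \<in> dual_basis n"
      by (auto simp: length_Suc_conv numeral_2_eq_2)
    then show "w \<in> ?h ` ?P" by (auto simp: dual_basis_def)
  qed
  then have "word_eval f r = (\<Sum>w\<in>?h ` ?P. Poly_Mapping.lookup r w * f w)"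
    by (intro word_eval_superset) (auto simp: finite_index_sets)
  also have "\<dots> = (\<Sum>p\<in>?P. Poly_Mapping.lookup r (?h p) * f (?h p))"
  proof (subst sum.reindex)
    show "inj_on ?h ?P" by (rule inj_onI) (auto dest: inj_onD[OF inj_on_dual_vec])
  qed simp
  also have "\<dots> = (\<Sum>(A, B)\<in>?P. perp_coeffs n r A B * f [dual_vec n A, dual_vec n B])"
    by (rule sum.cong) (auto simp: perp_coeffs_def)
  finally show ?thesis by (simp add: sum.cartesian_product)
qed

lemma tensor_pairing_conv_word_eval:
  "tensor_pairing q r = word_eval (\<lambda>u. word_eval (word_pairing u) r) q"
  by (simp add: tensor_pairing_def word_eval_def sum_distrib_left mult.assoc)

lemma word_eval_word_pairing:
  fixes r :: "'f::field dual_tensor"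
  assumes r: "r \<in> tensor_power (dual_basis n) 2" and A: "A \<subseteq> {1..n}" "B \<subseteq> {1..n}"
  shows "word_eval (\<lambda>u. word_eval (word_pairing u) r) (tv A * tv B) = perp_coeffs n r A B"
proof (cases "A = {} \<or> B = {}")
  case True
  then show ?thesis by (auto simp: tv_def perp_coeffs_def index_sets_def)
next
  case False
  then have AB: "A \<in> index_sets n" "B \<in> index_sets n" using A by (auto simp: index_sets_def)
  have "word_eval (\<lambda>u. word_eval (word_pairing u) r) (tv A * tv B) =
      word_eval (word_pairing [basis_vec A, basis_vec B]) r"
    using False by (simp add: tv_def mult_single plus_list_def)
  also have "\<dots> = (\<Sum>A'\<in>index_sets n. \<Sum>B'\<in>index_sets n. perp_coeffs n r A' B' *
      ((if A' = A then 1 else 0) * (if B' = B then 1 else 0)))"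
    unfolding word_eval_tensor_power_2[OF r]
    by (intro sum.cong refl) (simp add: dual_vec_basis_vec AB)
  also have "\<dots> = (\<Sum>A'\<in>index_sets n. if A' = A then (\<Sum>B'\<in>index_sets n. if B' = B then perp_coeffs n r A B else 0) else 0)"
    by (intro sum.cong refl) (auto intro!: sum.cong)
  also have "\<dots> = perp_coeffs n r A B" using AB by (simp add: sum.delta finite_index_sets)
  finally show ?thesis .
qed

lemma tensor_pairing_Q_rel:
  fixes r :: "'f::field dual_tensor"
  assumes r: "r \<in> tensor_power (dual_basis n) 2" and A: "A \<subseteq> {1..n}"
  defines "\<rho> \<equiv> perp_coeffs n r"
  shows "tensor_pairing (Q_rel A i j) r =
    (\<rho> A (A - {i}) + \<rho> (A - {i}) (A - {i, j}) - \<rho> (A - {i}) (A - {i})) -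
    (\<rho> A (A - {j}) + \<rho> (A - {j}) (A - {i, j}) - \<rho> (A - {j}) (A - {j}))"
proof -
  have sub: "A - S \<subseteq> {1..n}" for S using A by auto
  have diff: "word_eval f (p - q) = word_eval f p - word_eval f q" for f and p q :: "(nat set \<Rightarrow>\<^sub>0 'f) list \<Rightarrow>\<^sub>0 'f"
    using word_eval_add[of f p "- q"] by (simp add: word_eval_uminus)
  show ?thesis
    unfolding tensor_pairing_conv_word_eval Q_rel_def power2_eq_square right_diff_distrib left_diff_distrib
      diff word_eval_add \<rho>_def
    by (simp only: word_eval_word_pairing[OF r A sub] word_eval_word_pairing[OF r sub sub]) (simp add: algebra_simps)
qed

text \<open>The pairing is linear in its first argument, so it suffices to test the spanning
  elements, and each of them gives one equation between coefficients.\<close>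

lemma Q_perp_iff:
  fixes r :: "'f::field dual_tensor"
  assumes r: "r \<in> tensor_power (dual_basis n) 2"
  shows "r \<in> Q_perp n \<longleftrightarrow> quadratic_dual_coeffs {1..n} (perp_coeffs n r)"
proof -
  let ?G = "{Q_rel A i j :: (nat set \<Rightarrow>\<^sub>0 'f) list \<Rightarrow>\<^sub>0 'f | A i j. A \<subseteq> {1..n} \<and> i \<in> A \<and> j \<in> A \<and> i \<noteq> j}"
  have sub: "pm.subspace {q. tensor_pairing q r = 0}"
    unfolding pm.subspace_def tensor_pairing_conv_word_eval
    by (auto simp: word_eval_add word_eval_pm_scale)
  have "pm.span ?G \<subseteq> {q. tensor_pairing q r = 0} \<longleftrightarrow> ?G \<subseteq> {q. tensor_pairing q r = 0}"
    by (rule iffI, erule order_trans[OF pm.span_superset], erule pm.span_minimal[OF _ sub])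
  moreover have "r \<in> Q_perp n \<longleftrightarrow> pm.span ?G \<subseteq> {q. tensor_pairing q r = 0}"
    using r unfolding Q_perp_def Q_space_def by blast
  ultimately have "r \<in> Q_perp n \<longleftrightarrow> (\<forall>q\<in>?G. tensor_pairing q r = 0)" by blast
  also have "\<dots> \<longleftrightarrow> quadratic_dual_coeffs {1..n} (perp_coeffs n r)"
  proof -
    have zero: "perp_coeffs n r A {} = 0" "perp_coeffs n r {} A = 0" for A
      by (auto simp: perp_coeffs_def index_sets_def)
    have eq: "tensor_pairing (Q_rel A i j) r = 0 \<longleftrightarrow>
        perp_coeffs n r A (A - {i}) + perp_coeffs n r (A - {i}) (A - {i, j}) - perp_coeffs n r (A - {i}) (A - {i}) =
        perp_coeffs n r A (A - {j}) + perp_coeffs n r (A - {j}) (A - {i, j}) - perp_coeffs n r (A - {j}) (A - {j})"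
      if "A \<subseteq> {1..n}" for A i j
      unfolding tensor_pairing_Q_rel[OF r that] by (rule right_minus_eq)
    have "(\<forall>q\<in>?G. tensor_pairing q r = 0) \<longleftrightarrow>
        (\<forall>A i j. A \<subseteq> {1..n} \<longrightarrow> i \<in> A \<longrightarrow> j \<in> A \<longrightarrow> i \<noteq> j \<longrightarrow> tensor_pairing (Q_rel A i j) r = 0)"
      by blast
    then show ?thesis
      unfolding quadratic_dual_coeffs_def by (simp only: zero eq simp_thms cong: imp_cong)
  qed
  finally show ?thesis .
qed

text \<open>All relations needed for spanning have coefficients 0 and 1, so membership becomes a
  condition on an indicator function.\<close>

lemma sum_words_in_Q_perp:
  fixes n :: nat
  assumes S: "S \<subseteq> index_sets n \<times> index_sets n"
    and coeffs: "quadratic_dual_coeffs {1..n} (\<lambda>A B. of_bool ((A, B) \<in> S) :: 'f::field)"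
  shows "(\<Sum>(A, B)\<in>S. word_monomial (dual_vec n) [A, B]) \<in> (Q_perp n :: 'f dual_tensor set)"
proof -
  let ?r = "\<Sum>(A, B)\<in>S. word_monomial (dual_vec n) [A, B] :: 'f dual_tensor"
  have fin: "finite S" using S finite_index_sets finite_subset by blast
  have "Poly_Mapping.keys ?r \<subseteq> (\<Union>p\<in>S. Poly_Mapping.keys ((case p of (A, B) \<Rightarrow> word_monomial (dual_vec n) [A, B]) :: 'f dual_tensor))"
    by (rule keys_sum)
  also have "\<dots> \<subseteq> {w \<in> lists (dual_basis n). length w = 2}"
    by (auto simp: word_monomial_def dual_basis_def split: if_splits intro!: imageI dest!: subsetD[OF S])
  finally have r: "?r \<in> tensor_power (dual_basis n) 2" by (simp add: tensor_power_def)
  have "perp_coeffs n ?r A B = of_bool ((A, B) \<in> S)" for A B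
  proof (cases "A \<in> index_sets n \<and> B \<in> index_sets n")
    case True
    have "Poly_Mapping.lookup ?r [dual_vec n A, dual_vec n B] = (\<Sum>p\<in>S. if p = (A, B) then 1 else 0)"
      unfolding lookup_sum
    proof (rule sum.cong[OF refl])
      fix p assume p: "p \<in> S"
      obtain C D where CD: "p = (C, D)" by fastforce
      then have "C \<in> index_sets n" "D \<in> index_sets n" using p S by auto
      then have "(dual_vec n C :: (nat set \<Rightarrow>\<^sub>0 'f) \<Rightarrow> 'f) = dual_vec n A \<longleftrightarrow> C = A"
        "(dual_vec n D :: (nat set \<Rightarrow>\<^sub>0 'f) \<Rightarrow> 'f) = dual_vec n B \<longleftrightarrow> D = B"
        using True by (auto dest: inj_onD[OF inj_on_dual_vec])
      then show "Poly_Mapping.lookup ((case p of (C, D) \<Rightarrow> word_monomial (dual_vec n) [C, D]) :: 'f dual_tensor)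
          [dual_vec n A, dual_vec n B] = (if p = (A, B) then 1 else 0)"
        by (simp add: CD word_monomial_def lookup_single when_def)
    qed
    then show ?thesis using True fin by (simp add: perp_coeffs_def sum.delta)
  next
    case False
    then show ?thesis using S by (auto simp: perp_coeffs_def)
  qed
  then have "perp_coeffs n ?r = (\<lambda>A B. of_bool ((A, B) \<in> S))" by (intro ext)
  then show ?thesis using coeffs Q_perp_iff[OF r] by simp
qed

text \<open>The coefficient condition only involves pairs of equal sets and pairs in which the
  second set arises by removing one element of the first. A far pair is neither.\<close>

lemma far_in_Q_perp:
  assumes "A \<in> index_sets n" "B \<in> index_sets n" "A \<noteq> B" "\<And>l. l \<notin> B \<Longrightarrow> A \<noteq> insert l B"
  shows "word_monomial (dual_vec n) [A, B] \<in> (Q_perp n :: 'f::field dual_tensor set)"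
proof -
  have far: "(X, X - {i}) \<noteq> (A, B)" if "i \<in> X" for X :: "nat set" and i
    using assms(4)[of i] that by auto
  have far': "(X - {i}, X - {i, j}) \<noteq> (A, B)" if "i \<in> X" "j \<in> X" "i \<noteq> j" for X :: "nat set" and i j
  proof -
    have "X - {i, j} = X - {i} - {j}" "j \<in> X - {i}" using that by auto
    then show ?thesis using far[of j "X - {i}"] by simp
  qed
  have far'': "(X - {j}, X - {i, j}) \<noteq> (A, B)" if "i \<in> X" "j \<in> X" "i \<noteq> j" for X :: "nat set" and i j
    using far'[of j X i] that by (simp add: insert_commute)
  have "(\<Sum>(A, B)\<in>{(A, B)}. word_monomial (dual_vec n) [A, B]) \<in> (Q_perp n :: 'f dual_tensor set)"
  proof (rule sum_words_in_Q_perp)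
    show "quadratic_dual_coeffs {1..n} (\<lambda>X Y. of_bool ((X, Y) \<in> {(A, B)}) :: 'f)"
      unfolding quadratic_dual_coeffs_def singleton_iff
    proof (intro conjI allI impI)
      fix X :: "nat set" and i j assume ij: "i \<in> X" "j \<in> X" "i \<noteq> j"
      have ne: "(Y, Y) \<noteq> (A, B)" for Y using assms(3) by auto
      show "of_bool ((X, X - {i}) = (A, B)) + of_bool ((X - {i}, X - {i, j}) = (A, B)) - of_bool ((X - {i}, X - {i}) = (A, B)) =
        (of_bool ((X, X - {j}) = (A, B)) + of_bool ((X - {j}, X - {i, j}) = (A, B)) - of_bool ((X - {j}, X - {j}) = (A, B)) :: 'f)"
        by (simp only: far[OF ij(1)] far[OF ij(2)] far'[OF ij] far''[OF ij] ne)
    qed (use assms in \<open>auto simp: index_sets_def\<close>)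
  qed (use assms in auto)
  then show ?thesis by simp
qed

text \<open>The first and third terms on each side of the condition cancel, which leaves the test
  whether \<open>X - {i, j}\<close> is \<open>A\<close>, symmetric in \<open>i\<close> and
  \<open>j\<close>.\<close>

lemma sigma_left_in_Q_perp:
  assumes "A \<in> index_sets n"
  shows "(\<Sum>B\<in>index_sets n. word_monomial (dual_vec n) [B, A]) \<in> (Q_perp n :: 'f::field dual_tensor set)"
proof -
  have "(\<Sum>(X, Y)\<in>index_sets n \<times> {A}. word_monomial (dual_vec n) [X, Y]) \<in> (Q_perp n :: 'f dual_tensor set)"
  proof (rule sum_words_in_Q_perp)
    show "quadratic_dual_coeffs {1..n} (\<lambda>X Y. of_bool ((X, Y) \<in> index_sets n \<times> {A}) :: 'f)"
      unfolding quadratic_dual_coeffs_def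
    proof (intro conjI allI impI)
      fix X i j assume X: "X \<subseteq> {1..n}" "i \<in> X" "j \<in> X" "i \<noteq> j"
      then have "X \<in> index_sets n" "X - {i} \<in> index_sets n" "X - {j} \<in> index_sets n"
        by (auto simp: index_sets_def)
      then show "of_bool ((X, X - {i}) \<in> index_sets n \<times> {A}) + of_bool ((X - {i}, X - {i, j}) \<in> index_sets n \<times> {A})
          - of_bool ((X - {i}, X - {i}) \<in> index_sets n \<times> {A}) =
        (of_bool ((X, X - {j}) \<in> index_sets n \<times> {A}) + of_bool ((X - {j}, X - {i, j}) \<in> index_sets n \<times> {A})
          - of_bool ((X - {j}, X - {j}) \<in> index_sets n \<times> {A}) :: 'f)"
        by simp
    qed (use assms in \<open>auto simp: index_sets_def\<close>)
  qed (use assms in auto)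
  then show ?thesis by (simp add: sum.cartesian_product[symmetric])
qed

text \<open>If \<open>X - {i, j}\<close> is nonempty, the last two terms on each side cancel and the
  test whether \<open>X\<close> is \<open>A\<close> remains. If it is empty, the sets
  \<open>X - {i}\<close> and \<open>X - {j}\<close> are singletons, hence different from
  \<open>A\<close>; this is where \<open>2 \<le> card A\<close> is used.\<close>

lemma sigma_right_in_Q_perp:
  assumes A: "A \<in> index_sets n" "2 \<le> card A"
  shows "(\<Sum>B\<in>index_sets n. word_monomial (dual_vec n) [A, B]) \<in> (Q_perp n :: 'f::field dual_tensor set)"
proof -
  have ne: "A - {j} \<noteq> {}" for j
  proof
    assume "A - {j} = {}"
    then have "A \<subseteq> {j}" by auto
    then have "card A \<le> 1" using card_mono[of "{j}" A] by simp
    then show False using A by simp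
  qed
  have "(\<Sum>(X, Y)\<in>{A} \<times> index_sets n. word_monomial (dual_vec n) [X, Y]) \<in> (Q_perp n :: 'f dual_tensor set)"
  proof (rule sum_words_in_Q_perp)
    show "quadratic_dual_coeffs {1..n} (\<lambda>X Y. of_bool ((X, Y) \<in> {A} \<times> index_sets n) :: 'f)"
      unfolding quadratic_dual_coeffs_def
    proof (intro conjI allI impI)
      fix X i j assume X: "X \<subseteq> {1..n}" "i \<in> X" "j \<in> X" "i \<noteq> j"
      then have N: "X - {i} \<in> index_sets n" "X - {j} \<in> index_sets n"
        by (auto simp: index_sets_def)
      have P: "X - {i, j} \<in> index_sets n \<or> (X - {i} \<noteq> A \<and> X - {j} \<noteq> A)"
      proof (rule disjCI)
        assume "\<not> (X - {i} \<noteq> A \<and> X - {j} \<noteq> A)"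
        then have "X - {i, j} = A - {j} \<or> X - {i, j} = A - {i}" by blast
        then have "X - {i, j} \<noteq> {}" using ne by metis
        then show "X - {i, j} \<in> index_sets n" using X(1) by (auto simp: index_sets_def)
      qed
      show "of_bool ((X, X - {i}) \<in> {A} \<times> index_sets n) + of_bool ((X - {i}, X - {i, j}) \<in> {A} \<times> index_sets n)
          - of_bool ((X - {i}, X - {i}) \<in> {A} \<times> index_sets n) =
        (of_bool ((X, X - {j}) \<in> {A} \<times> index_sets n) + of_bool ((X - {j}, X - {i, j}) \<in> {A} \<times> index_sets n)
          - of_bool ((X - {j}, X - {j}) \<in> {A} \<times> index_sets n) :: 'f)"
        using P by (elim disjE conjE)
          (simp_all only: N simp_thms mem_Sigma_iff singleton_iff add_diff_cancel_right' of_bool_eq add_0_right diff_0_right)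
    qed (use assms in \<open>auto simp: index_sets_def\<close>)
  qed (use assms in auto)
  then show ?thesis by (simp add: sum.cartesian_product[symmetric])
qed

section \<open>The ideal of the dual algebra and the functionals that kill it\<close>

abbreviation dual_ideal :: "nat \<Rightarrow> 'f::field dual_tensor set" where
  "dual_ideal n \<equiv> Idl\<^bsub>tensor_algebra (dual_basis n)\<^esub> (Q_perp n)"

lemma Q_perp_subset: "Q_perp n \<subseteq> carrier (tensor_algebra (dual_basis n))"
  using tensor_power_subset by (auto simp: Q_perp_def)

lemma word_monomial_in_carrier:
  assumes "set w \<subseteq> index_sets n"
  shows "(word_monomial (dual_vec n) w :: 'f::field dual_tensor) \<in> carrier (tensor_algebra (dual_basis n))"
  using assms by (fastforce simp: tensor_algebra_def word_monomial_def dual_basis_def)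

lemma sigma_ideal_dual_ideal:
  "sigma_ideal {1..n} (dual_vec n) (dual_ideal n :: 'f::field dual_tensor set)"
proof -
  let ?T = "tensor_algebra (dual_basis n) :: 'f dual_tensor ring"
  let ?I = "dual_ideal n :: 'f dual_tensor set"
  interpret T: ring ?T by (rule ring_tensor_algebra)
  interpret I: ideal ?I ?T using Q_perp_subset by (rule T.genideal_ideal)
  have ops: "monoid.mult ?T = (*)" "add ?T = (+)" "zero ?T = 0"
    by (auto simp: tensor_algebra_def)
  have left: "a * p \<in> ?I" if "p \<in> ?I" "a \<in> carrier ?T" for a p
    using I.I_l_closed[OF that] by (simp add: ops)
  have right: "p * a \<in> ?I" if "p \<in> ?I" "a \<in> carrier ?T" for a p
    using I.I_r_closed[OF that] by (simp add: ops)
  have gen: "p \<in> ?I" if "p \<in> Q_perp n" for p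
    using T.genideal_self[OF Q_perp_subset] that by blast
  have split: "word_monomial (dual_vec n) (A # B # w) =
      (word_monomial (dual_vec n) [A, B] * word_monomial (dual_vec n) w :: 'f dual_tensor)" for A B w
    by (simp add: word_monomial_def mult_single plus_list_def)
  show ?thesis
  proof
    show "pm.subspace ?I"
    proof (rule pm.subspaceI)
      show "0 \<in> ?I" using I.zero_closed by (simp add: ops)
      show "p + q \<in> ?I" if "p \<in> ?I" "q \<in> ?I" for p q using I.a_closed[OF that] by (simp add: ops)
      show "pm_scale c p \<in> ?I" if "p \<in> ?I" for c p
        unfolding pm_scale_conv_times
        by (rule left[OF that]) (auto simp: tensor_algebra_def split: if_splits)
    qed
    fix p A assume p: "p \<in> ?I" and A: "A \<in> nonempty_subsets {1..n}"
    show "left_mult (dual_vec n) A p \<in> ?I"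
      unfolding left_mult_def
      by (rule left[OF p]) (use A word_monomial_in_carrier[of "[A]" n] in \<open>simp add: word_monomial_def index_sets_eq\<close>)
  next
    fix A B w assume "A \<in> nonempty_subsets {1..n}" "B \<in> nonempty_subsets {1..n}" "A \<noteq> B"
      "\<And>l. l \<notin> B \<Longrightarrow> A \<noteq> insert l B" "set w \<subseteq> nonempty_subsets {1..n}"
    then show "word_monomial (dual_vec n) (A # B # w) \<in> ?I"
      unfolding split[of A B w] by (intro right gen far_in_Q_perp word_monomial_in_carrier) (auto simp: index_sets_eq)
  next
    fix A w assume "A \<in> nonempty_subsets {1..n}" "set w \<subseteq> nonempty_subsets {1..n}"
    then have "(\<Sum>B\<in>index_sets n. word_monomial (dual_vec n) [B, A]) * word_monomial (dual_vec n) w \<in> ?I"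
      by (intro right gen sigma_left_in_Q_perp word_monomial_in_carrier) (auto simp: index_sets_eq)
    then show "(\<Sum>B\<in>nonempty_subsets {1..n}. word_monomial (dual_vec n) (B # A # w)) \<in> ?I"
      unfolding split[of _ A w] by (simp only: index_sets_eq sum_distrib_right)
  next
    fix A w assume "A \<in> nonempty_subsets {1..n}" "2 \<le> card A" "set w \<subseteq> nonempty_subsets {1..n}"
    then have "(\<Sum>B\<in>index_sets n. word_monomial (dual_vec n) [A, B]) * word_monomial (dual_vec n) w \<in> ?I"
      by (intro right gen sigma_right_in_Q_perp word_monomial_in_carrier) (auto simp: index_sets_eq)
    then show "(\<Sum>B\<in>nonempty_subsets {1..n}. word_monomial (dual_vec n) (A # B # w)) \<in> ?I"
      unfolding split[of A _ w] by (simp only: index_sets_eq sum_distrib_right)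
  qed simp
qed

text \<open>The generators are homogeneous of degree 2, so the constant coefficient vanishes on the
  whole ideal.\<close>

lemma one_notin_dual_ideal: "(1 :: 'f::field dual_tensor) \<notin> dual_ideal n"
proof
  have one: "(1 :: 'f dual_tensor) = Poly_Mapping.single [] 1"
    by (simp add: zero_list_def flip: single_one)
  let ?f = "\<lambda>w. of_bool (w = []) :: 'f"
  assume "(1 :: 'f dual_tensor) \<in> dual_ideal n"
  then have "word_eval ?f (1 :: 'f dual_tensor) = 0"
  proof (rule word_eval_Idl[OF Q_perp_subset, rotated])
    fix r :: "'f dual_tensor" and u v :: "((nat set \<Rightarrow>\<^sub>0 'f) \<Rightarrow> 'f) list" assume r: "r \<in> Q_perp n"
    show "word_eval (\<lambda>w. ?f (u @ w @ v)) r = 0"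
      unfolding word_eval_def
      by (rule sum.neutral) (use r in \<open>auto simp: Q_perp_def tensor_power_def\<close>)
  qed
  then show False unfolding one by simp
qed

text \<open>Words in the dual basis are translated back to words of sets by inverting
  \<open>dual_vec\<close>; the ideal criterion then reduces the claim to single relations between
  two words.\<close>

lemma word_functional_dual_ideal:
  fixes g :: "nat set \<Rightarrow> nat set \<Rightarrow> 'f::field" and p :: "'f dual_tensor"
  assumes g: "balanced {1..n} g" and p: "p \<in> dual_ideal n"
  shows "word_eval (\<lambda>w. word_functional {1..n} g (map (inv_into (index_sets n) (dual_vec n)) w)) p = 0"
  using Q_perp_subset _ p
proof (rule word_eval_Idl)
  let ?y = "inv_into (index_sets n) (dual_vec n :: nat set \<Rightarrow> (nat set \<Rightarrow>\<^sub>0 'f) \<Rightarrow> 'f)"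
  fix r :: "'f dual_tensor" and u v :: "((nat set \<Rightarrow>\<^sub>0 'f) \<Rightarrow> 'f) list"
  assume r: "r \<in> Q_perp n" and v: "v \<in> lists (dual_basis n)"
  then have r2: "r \<in> tensor_power (dual_basis n) 2" by (simp add: Q_perp_def)
  have y: "?y (dual_vec n A) = A" if "A \<in> index_sets n" for A
    by (rule inv_into_f_f[OF inj_on_dual_vec that])
  have "word_eval (\<lambda>w. word_functional {1..n} g (map ?y (u @ w @ v))) r =
      (\<Sum>A\<in>nonempty_subsets {1..n}. \<Sum>B\<in>nonempty_subsets {1..n}.
        perp_coeffs n r A B * word_functional {1..n} g (map ?y u @ [A, B] @ map ?y v))"
    unfolding word_eval_tensor_power_2[OF r2] index_sets_eq[symmetric]
    by (intro sum.cong refl) (simp add: y)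
  also have "\<dots> = 0"
  proof (rule word_functional_annihilates)
    show "quadratic_dual_coeffs {1..n} (perp_coeffs n r)" using r Q_perp_iff[OF r2] by simp
    show "set (map ?y v) \<subseteq> nonempty_subsets {1..n}"
      using v inv_dual_vec_in by auto
  qed (use g in auto)
  finally show "word_eval (\<lambda>w. word_functional {1..n} g (map ?y (u @ w @ v))) r = 0" .
qed

text \<open>The pivot functional of \<open>(C, D)\<close> turns a dependency into an equation
  between \<open>c (C, D)\<close> and the coefficient at \<open>C\<close> without its maximum, read
  as zero if that is not a basis pair. The latter vanishes by induction on
  \<open>card C\<close>.\<close>

lemma basis_words_independent:
  fixes c :: "nat set \<times> nat set \<Rightarrow> 'f::field"
  assumes sum: "(\<Sum>b\<in>basis_pairs {1..n} k. pm_scale (c b) (case b of (C, D) \<Rightarrow> word_monomial (dual_vec n) (set_word C D)))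
      \<in> (dual_ideal n :: 'f dual_tensor set)"
    and b: "(C, D) \<in> basis_pairs {1..n} k"
  shows "c (C, D) = 0"
  using b
proof (induction "card C" arbitrary: C D rule: less_induct)
  case (less C1 D1)
  let ?S = "basis_pairs {1..n} k"
  let ?g = "pivot_functional {1..n} (Max C1) (C1 - {Max C1}) D1 :: nat set \<Rightarrow> nat set \<Rightarrow> 'f"
  let ?f = "\<lambda>w. word_functional {1..n} ?g (map (inv_into (index_sets n) (dual_vec n)) w)"
  let ?E = "\<lambda>C D. word_monomial (dual_vec n) (set_word C D) :: 'f dual_tensor"
  have C1: "finite C1" "C1 \<noteq> {}" "C1 \<subseteq> {1..n}"
    using less.prems finite_subset[of C1 "{1..n}"] by (auto simp: basis_pairs_def)
  then have max: "Max C1 \<in> C1" by simp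
  have fin: "finite ?S" by (simp add: finite_basis_pairs)
  have "balanced {1..n} ?g" by (rule balanced_pivot_functional[OF _ subsetD[OF C1(3) max]]) simp
  from word_functional_dual_ideal[OF this sum]
  have "0 = (\<Sum>b\<in>?S. c b * word_eval ?f (case b of (C, D) \<Rightarrow> ?E C D))"
    by (simp add: word_eval_sum word_eval_pm_scale)
  also have "\<dots> = (\<Sum>b\<in>?S. (if b = (C1, D1) then c b else 0) - (if b = (C1 - {Max C1}, D1) then c b else 0))"
  proof (rule sum.cong[OF refl])
    fix b assume b: "b \<in> ?S"
    obtain C D where CD: "b = (C, D)" by fastforce
    have D: "finite D" "C \<in> nonempty_subsets {1..n}" "D \<subseteq> {1..n}" "C \<inter> D = {}" "C \<subseteq> {1..n}"
      using b CD finite_subset[of D "{1..n}"] by (auto simp: basis_pairs_def nonempty_subsets_def)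
    have "map (inv_into (index_sets n) (dual_vec n)) (map (dual_vec n :: _ \<Rightarrow> (nat set \<Rightarrow>\<^sub>0 'f) \<Rightarrow> 'f) (set_word C D)) = set_word C D"
      unfolding map_map
    proof (rule map_idI)
      fix A assume "A \<in> set (set_word C D)"
      then have "A \<in> index_sets n" using set_set_word[OF D(1-3)] by (auto simp: index_sets_eq)
      then show "(inv_into (index_sets n) (dual_vec n) \<circ> (dual_vec n :: _ \<Rightarrow> (nat set \<Rightarrow>\<^sub>0 'f) \<Rightarrow> 'f)) A = A"
        using inv_into_f_f[OF inj_on_dual_vec] by simp
    qed
    then have "word_eval ?f (?E C D) = ?g C D"
      using word_functional_set_word[of "{1..n}" D C ?g] D by (simp add: word_monomial_def)
    also have "\<dots> = of_bool ((C, D) = (C1, D1)) - of_bool ((C, D) = (C1 - {Max C1}, D1))"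
      by (rule pivot_functional_basis_pair) (use b CD less.prems in auto)
    finally show "c b * word_eval ?f (case b of (C, D) \<Rightarrow> ?E C D) =
      (if b = (C1, D1) then c b else 0) - (if b = (C1 - {Max C1}, D1) then c b else 0)"
      by (simp add: CD)
  qed
  also have "\<dots> = c (C1, D1) - (if (C1 - {Max C1}, D1) \<in> ?S then c (C1 - {Max C1}, D1) else 0)"
    using less.prems fin by (simp add: sum_subtractf sum.delta)
  also have "(if (C1 - {Max C1}, D1) \<in> ?S then c (C1 - {Max C1}, D1) else 0) = 0"
    using less.hyps[of "C1 - {Max C1}" D1] card_Diff1_less[OF C1(1) max] by simp
  finally show ?case by simp
qed

lemma Q_dual_component_dimension:
  shows "ring.finite_dimension (Q_dual n :: 'f::field dual_tensor set ring) (Q_dual_scalars n) (Q_dual_component n i)"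
    and "ring.dim (Q_dual n :: 'f dual_tensor set ring) (Q_dual_scalars n) (Q_dual_component n i) =
      (case i of 0 \<Rightarrow> 1 | Suc k \<Rightarrow> card (basis_pairs {1..n} k))"
proof -
  let ?I = "dual_ideal n :: 'f dual_tensor set"
  let ?B = "dual_basis n :: ((nat set \<Rightarrow>\<^sub>0 'f) \<Rightarrow> 'f) set"
  interpret sigma_ideal "{1..n}" "dual_vec n" ?I by (rule sigma_ideal_dual_ideal)
  have "ring.finite_dimension (Q_dual n :: 'f dual_tensor set ring) (Q_dual_scalars n) (Q_dual_component n i) \<and>
    ring.dim (Q_dual n :: 'f dual_tensor set ring) (Q_dual_scalars n) (Q_dual_component n i) =
      (case i of 0 \<Rightarrow> 1 | Suc k \<Rightarrow> card (basis_pairs {1..n} k))"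
  proof (cases i)
    \<comment> \<open>In degree 0 the basis is the single element \<open>1\<close>, indexed by the
      unit type.\<close>
    case 0
    have scale_1: "pm_scale c 1 = (Poly_Mapping.single [] c :: 'f dual_tensor)" for c
      by (simp add: zero_list_def flip: single_one)
    have e: "(1 :: 'f dual_tensor) \<in> tensor_power ?B 0" if "u \<in> {()}" for u
      by (auto simp: tensor_power_def zero_list_def)
    have span: "\<exists>c. p - (\<Sum>u\<in>{()}. pm_scale (c u) 1) \<in> ?I" if "p \<in> tensor_power ?B 0" for p
    proof -
      have "p = Poly_Mapping.single [] (Poly_Mapping.lookup p [])"
        by (rule poly_mapping_eqI) (use that in \<open>auto simp: tensor_power_def lookup_single when_def in_keys_iff\<close>)
      then have "p - (\<Sum>u\<in>{()}. pm_scale (Poly_Mapping.lookup p []) 1) = 0"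
        by (simp add: scale_1)
      then show ?thesis using I_closed(4) by (intro exI[of _ "\<lambda>_. Poly_Mapping.lookup p []"]) (simp only:)
    qed
    have indep: "c u = 0" if sum: "(\<Sum>u\<in>{()}. pm_scale (c u) 1) \<in> ?I" and "u \<in> {()}" for c u
    proof (rule ccontr)
      assume "c u \<noteq> 0"
      then have "pm_scale (inverse (c u)) (pm_scale (c u) 1) = (1 :: 'f dual_tensor)" by simp
      moreover have "pm_scale (inverse (c u)) (pm_scale (c u) 1) \<in> ?I"
        by (rule I_closed(3)) (use sum in simp)
      ultimately show False using one_notin_dual_ideal by metis
    qed
    note dims = quadratic_component_dimension[OF Q_perp_subset one_notin_dual_ideal, where e = "\<lambda>_. 1" and X = "{()}"]
    have "ring.finite_dimension (quadratic_algebra ?B (Q_perp n)) (quadratic_scalars ?B (Q_perp n)) (quadratic_component ?B (Q_perp n) 0)"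
      by (rule dims(1); (fact e | fact span | fact indep | simp))
    moreover have "ring.dim (quadratic_algebra ?B (Q_perp n)) (quadratic_scalars ?B (Q_perp n)) (quadratic_component ?B (Q_perp n) 0) = card {()}"
      by (rule dims(2); (fact e | fact span | fact indep | simp))
    ultimately show ?thesis
      unfolding Q_dual_def Q_dual_scalars_def Q_dual_component_def by (simp add: 0)
  next
    case (Suc k)
    let ?E = "(\<lambda>(C, D). word_monomial (dual_vec n) (set_word C D)) :: nat set \<times> nat set \<Rightarrow> 'f dual_tensor"
    have e: "?E b \<in> tensor_power ?B (Suc k)" if "b \<in> basis_pairs {1..n} k" for b
    proof -
      obtain C D where CD: "b = (C, D)" by fastforce
      have D: "finite D" "C \<in> nonempty_subsets {1..n}" "D \<subseteq> {1..n}" "card D = k"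
        using that CD finite_subset[of D "{1..n}"] by (auto simp: basis_pairs_def nonempty_subsets_def)
      show ?thesis
        using set_set_word[OF D(1-3)] length_set_word[OF D(1), of C] D(4)
        by (auto simp: CD tensor_power_def word_monomial_def dual_basis_def index_sets_eq intro!: imageI)
    qed
    have span: "\<exists>c. p - (\<Sum>b\<in>basis_pairs {1..n} k. pm_scale (c b) (?E b)) \<in> ?I"
      if p: "p \<in> tensor_power ?B (Suc k)" for p
    proof (rule basis_span_expansion)
      have "Poly_Mapping.single w (Poly_Mapping.lookup p w) \<in> basis_span k" if "w \<in> Poly_Mapping.keys p" for w
      proof -
        let ?y = "inv_into (index_sets n) (dual_vec n :: nat set \<Rightarrow> (nat set \<Rightarrow>\<^sub>0 'f) \<Rightarrow> 'f)"
        have w: "set w \<subseteq> dual_vec n ` index_sets n" "length w = Suc k"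
          using p that by (auto simp: tensor_power_def dual_basis_def)
        have "map (dual_vec n) (map ?y w) = w"
          unfolding map_map
        proof (rule map_idI)
          fix b assume "b \<in> set w"
          then have "b \<in> dual_vec n ` index_sets n" using w by auto
          then show "(dual_vec n \<circ> ?y) b = b" by (simp add: f_inv_into_f)
        qed
        then have "Poly_Mapping.single w (Poly_Mapping.lookup p w) =
            pm_scale (Poly_Mapping.lookup p w) (word_monomial (dual_vec n) (map ?y w))"
          by (simp add: word_monomial_def)
        moreover have "word_monomial (dual_vec n) (map ?y w) \<in> basis_span k"
        proof (rule word_in_basis_span)
          show "set (map ?y w) \<subseteq> nonempty_subsets {1..n}"
            using w(1) inv_dual_vec_in by (auto simp: dual_basis_def)
        qed (use w in simp)
        ultimately show ?thesis unfolding basis_span_def by (simp only: pm.span_scale)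
      qed
      then have "(\<Sum>w\<in>Poly_Mapping.keys p. Poly_Mapping.single w (Poly_Mapping.lookup p w)) \<in> basis_span k"
        unfolding basis_span_def by (rule pm.span_sum)
      then show "p \<in> basis_span k" using poly_mapping_sum_keys[of p] by simp
    qed
    have indep: "c b = 0"
      if "(\<Sum>b\<in>basis_pairs {1..n} k. pm_scale (c b) (?E b)) \<in> ?I" "b \<in> basis_pairs {1..n} k" for c b
      using basis_words_independent[OF that(1), of "fst b" "snd b"] that(2) by simp
    note dims = quadratic_component_dimension[OF Q_perp_subset one_notin_dual_ideal, where e = ?E and X = "basis_pairs {1..n} k"]
    have "ring.finite_dimension (quadratic_algebra ?B (Q_perp n)) (quadratic_scalars ?B (Q_perp n)) (quadratic_component ?B (Q_perp n) (Suc k))"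
      by (rule dims(1); (fact e | fact span | fact indep | simp add: finite_basis_pairs))
    moreover have "ring.dim (quadratic_algebra ?B (Q_perp n)) (quadratic_scalars ?B (Q_perp n)) (quadratic_component ?B (Q_perp n) (Suc k)) =
        card (basis_pairs {1..n} k)"
      by (rule dims(2); (fact e | fact span | fact indep | simp add: finite_basis_pairs))
    ultimately show ?thesis
      unfolding Q_dual_def Q_dual_scalars_def Q_dual_component_def by (simp add: Suc)
  qed
  then show "ring.finite_dimension (Q_dual n :: 'f dual_tensor set ring) (Q_dual_scalars n) (Q_dual_component n i)"
    and "ring.dim (Q_dual n :: 'f dual_tensor set ring) (Q_dual_scalars n) (Q_dual_component n i) =
      (case i of 0 \<Rightarrow> 1 | Suc k \<Rightarrow> card (basis_pairs {1..n} k))" by auto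
qed

section \<open>Counting basis words\<close>

definition disjoint_pairs :: "nat \<Rightarrow> nat \<Rightarrow> (nat set \<times> nat set) set" where
  "disjoint_pairs m k = {(C, D). C \<subseteq> {1..m} \<and> D \<subseteq> {1..m} \<and> C \<inter> D = {} \<and> card D = k}"

lemma finite_disjoint_pairs: "finite (disjoint_pairs m k)"
  by (rule finite_subset[of _ "Pow {1..m} \<times> Pow {1..m}"]) (auto simp: disjoint_pairs_def)

text \<open>The new element \<open>Suc m\<close> lies in neither set, in \<open>C\<close>, or in
  \<open>D\<close>. Only the last choice uses up one of the \<open>k\<close> elements of
  \<open>D\<close>.\<close>

lemma card_disjoint_pairs_Suc:
  "card (disjoint_pairs (Suc m) k) = 2 * card (disjoint_pairs m k) +
    (case k of 0 \<Rightarrow> 0 | Suc j \<Rightarrow> card (disjoint_pairs m j))"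
proof -
  let ?P = "disjoint_pairs m"
  let ?R = "case k of 0 \<Rightarrow> {} | Suc j \<Rightarrow> (\<lambda>(C, D). (C, insert (Suc m) D)) ` ?P j"
  let ?L = "(\<lambda>(C, D). (insert (Suc m) C, D)) ` ?P k"
  have new: "Suc m \<notin> C" "Suc m \<notin> D" "finite D" if "(C, D) \<in> ?P j" for C D j
    using that finite_subset[of D "{1..m}"] by (auto simp: disjoint_pairs_def)
  have sub: "X - {Suc m} \<subseteq> {1..m}" if "X \<subseteq> {1..Suc m}" for X
    using that by (auto simp: atLeastAtMostSuc_conv)
  have "disjoint_pairs (Suc m) k = ?P k \<union> (?L \<union> ?R)"
  proof
    show "disjoint_pairs (Suc m) k \<subseteq> ?P k \<union> (?L \<union> ?R)"
    proof
      fix p assume "p \<in> disjoint_pairs (Suc m) k"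
      then obtain C D where p: "p = (C, D)" "C \<subseteq> {1..Suc m}" "D \<subseteq> {1..Suc m}" "C \<inter> D = {}" "card D = k"
        by (auto simp: disjoint_pairs_def)
      have fD: "finite D" using p finite_subset by blast
      consider "Suc m \<in> C" | "Suc m \<in> D" | "Suc m \<notin> C" "Suc m \<notin> D" by blast
      then show "p \<in> ?P k \<union> (?L \<union> ?R)"
      proof cases
        case 1
        then have "D - {Suc m} = D" using p by auto
        then have "(C - {Suc m}, D) \<in> ?P k" using p sub[of C] sub[of D] by (auto simp: disjoint_pairs_def)
        moreover have "p = (\<lambda>(C, D). (insert (Suc m) C, D)) (C - {Suc m}, D)" using p 1 by auto
        ultimately show ?thesis by blast
      next
        case 2
        then obtain j where j: "k = Suc j" using p fD by (cases k) auto
        have "C - {Suc m} = C" using 2 p by auto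
        then have "(C, D - {Suc m}) \<in> ?P j"
          using p sub[of C] sub[of D] 2 fD j by (auto simp: disjoint_pairs_def)
        moreover have "p = (\<lambda>(C, D). (C, insert (Suc m) D)) (C, D - {Suc m})" using p 2 by auto
        ultimately have "p \<in> (\<lambda>(C, D). (C, insert (Suc m) D)) ` ?P j" by blast
        then show ?thesis by (simp add: j)
      next
        case 3
        then have "C - {Suc m} = C" "D - {Suc m} = D" by auto
        then have "(C, D) \<in> ?P k" using p sub[of C] sub[of D] by (simp add: disjoint_pairs_def)
        then show ?thesis using p by blast
      qed
    qed
    show "?P k \<union> (?L \<union> ?R) \<subseteq> disjoint_pairs (Suc m) k"
    proof -
      have "(C, D) \<in> disjoint_pairs (Suc m) k" "(insert (Suc m) C, D) \<in> disjoint_pairs (Suc m) k"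
        if "(C, D) \<in> ?P k" for C D
        using that new[OF that] by (auto simp: disjoint_pairs_def)
      moreover have "(C, insert (Suc m) D) \<in> disjoint_pairs (Suc m) (Suc j)" if "(C, D) \<in> ?P j" for C D j
        using that new[OF that] by (auto simp: disjoint_pairs_def)
      ultimately show ?thesis by (auto split: nat.splits)
    qed
  qed
  moreover have "?P k \<inter> (?L \<union> ?R) = {}" "?L \<inter> ?R = {}"
    by (auto split: nat.splits dest: new)
  moreover have "finite ?L" "finite ?R" using finite_disjoint_pairs by (auto split: nat.splits)
  ultimately have "card (disjoint_pairs (Suc m) k) = card (?P k) + (card ?L + card ?R)"
    using finite_disjoint_pairs by (simp add: card_Un_disjoint)
  also have "card ?L = card (?P k)"
  proof (rule card_image, rule inj_onI)
    fix p q assume pq: "p \<in> ?P k" "q \<in> ?P k"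
      "(case p of (C, D) \<Rightarrow> (insert (Suc m) C, D)) = (case q of (C, D) \<Rightarrow> (insert (Suc m) C, D))"
    obtain C D C' D' where "p = (C, D)" "q = (C', D')" by fastforce
    with pq new show "p = q" by (auto dest: insert_ident[THEN iffD1, rotated 2])
  qed
  also have "card ?R = (case k of 0 \<Rightarrow> 0 | Suc j \<Rightarrow> card (?P j))"
  proof (cases k)
    case (Suc j)
    have "card ((\<lambda>(C, D). (C, insert (Suc m) D)) ` ?P j) = card (?P j)"
    proof (rule card_image, rule inj_onI)
      fix p q assume pq: "p \<in> ?P j" "q \<in> ?P j"
        "(case p of (C, D) \<Rightarrow> (C, insert (Suc m) D)) = (case q of (C, D) \<Rightarrow> (C, insert (Suc m) D))"
      obtain C D C' D' where "p = (C, D)" "q = (C', D')" by fastforce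
      with pq new show "p = q" by (auto dest: insert_ident[THEN iffD1, rotated 2])
    qed
    then show ?thesis using Suc by simp
  qed simp
  finally show ?thesis by simp
qed

lemma disjoint_pairs_fps:
  "Abs_fps (\<lambda>k. of_nat (card (disjoint_pairs m k))) = (2 + fps_X :: rat fps) ^ m"
proof (induction m)
  case 0
  have "disjoint_pairs 0 k = (if k = 0 then {({}, {})} else {})" for k
    by (auto simp: disjoint_pairs_def)
  then show ?case by (intro fps_ext) simp
next
  case (Suc m)
  let ?F = "Abs_fps (\<lambda>k. of_nat (card (disjoint_pairs m k))) :: rat fps"
  have "Abs_fps (\<lambda>k. of_nat (card (disjoint_pairs (Suc m) k))) = 2 * ?F + fps_X * ?F"
    by (intro fps_ext) (simp add: card_disjoint_pairs_Suc numeral_fps_const fps_X_mult_nth split: nat.split)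
  then show ?case using Suc.IH by (simp add: algebra_simps)
qed

text \<open>\<open>Suc m\<close> cannot lie in \<open>D\<close>, whose elements are below
  \<open>Max C\<close>. If it lies in \<open>C\<close>, it is the maximum and the bound on
  \<open>D\<close> holds automatically, so the rest is an arbitrary disjoint pair in which the first
  set may be empty.\<close>

lemma basis_pairs_Suc:
  "basis_pairs {1..Suc m} k =
    basis_pairs {1..m} k \<union> (\<lambda>(C, D). (insert (Suc m) C, D)) ` disjoint_pairs m k"
proof
  show "basis_pairs {1..Suc m} k \<subseteq>
      basis_pairs {1..m} k \<union> (\<lambda>(C, D). (insert (Suc m) C, D)) ` disjoint_pairs m k"
  proof
    fix p assume "p \<in> basis_pairs {1..Suc m} k"
    then obtain C D where p: "p = (C, D)" "C \<noteq> {}" "C \<subseteq> {1..Suc m}" "D \<subseteq> {1..Suc m}" "C \<inter> D = {}" "card D = k"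
      "\<forall>d\<in>D. d < Max C" by (auto simp: basis_pairs_def)
    have fC: "finite C" using p finite_subset by blast
    then have "Max C \<le> Suc m" using p Max_in[OF fC] by auto
    then have "Suc m \<notin> D" using p(7) by auto
    then have D: "D \<subseteq> {1..m}" using p(4) by (auto simp: atLeastAtMostSuc_conv)
    show "p \<in> basis_pairs {1..m} k \<union> (\<lambda>(C, D). (insert (Suc m) C, D)) ` disjoint_pairs m k"
    proof (cases "Suc m \<in> C")
      case True
      have "C - {Suc m} \<subseteq> {1..m}" using p(3) by (auto simp: atLeastAtMostSuc_conv)
      then have "(C - {Suc m}, D) \<in> disjoint_pairs m k" using p D by (auto simp: disjoint_pairs_def)
      moreover have "p = (\<lambda>(C, D). (insert (Suc m) C, D)) (C - {Suc m}, D)" using p True by auto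
      ultimately show ?thesis by blast
    next
      case False
      then have "C \<subseteq> {1..m}" using p(3) by (auto simp: atLeastAtMostSuc_conv)
      then show ?thesis using p D by (simp add: basis_pairs_def)
    qed
  qed
  show "basis_pairs {1..m} k \<union> (\<lambda>(C, D). (insert (Suc m) C, D)) ` disjoint_pairs m k
      \<subseteq> basis_pairs {1..Suc m} k"
  proof -
    have "(insert (Suc m) C, D) \<in> basis_pairs {1..Suc m} k" if CD: "(C, D) \<in> disjoint_pairs m k" for C D
    proof -
      have C: "C \<subseteq> {1..m}" "D \<subseteq> {1..m}" "C \<inter> D = {}" "card D = k" using CD by (auto simp: disjoint_pairs_def)
      have "finite C" using C finite_subset by blast
      then have "Max (insert (Suc m) C) = Suc m" using C by (intro Max_eqI) fastforce+
      then show ?thesis using C unfolding basis_pairs_def by (auto simp: less_Suc_eq_le)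
    qed
    then show ?thesis by (fastforce simp: basis_pairs_def)
  qed
qed

lemma card_basis_pairs: "card (basis_pairs {1..n} k) = (\<Sum>m<n. card (disjoint_pairs m k))"
proof (induction n)
  case 0
  have "basis_pairs {1..0} k = {}" by (auto simp: basis_pairs_def)
  then show ?case by simp
next
  case (Suc m)
  let ?g = "\<lambda>(C, D). (insert (Suc m) C, D)"
  have new: "Suc m \<notin> C" if "(C, D) \<in> disjoint_pairs m k" for C D
    using that by (auto simp: disjoint_pairs_def)
  have "inj_on ?g (disjoint_pairs m k)"
  proof (rule inj_onI)
    fix p q assume pq: "p \<in> disjoint_pairs m k" "q \<in> disjoint_pairs m k" "?g p = ?g q"
    obtain C D C' D' where "p = (C, D)" "q = (C', D')" by fastforce
    with pq new show "p = q" by (auto dest: insert_ident[THEN iffD1, rotated 2])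
  qed
  then have "card (?g ` disjoint_pairs m k) = card (disjoint_pairs m k)" by (rule card_image)
  moreover have "basis_pairs {1..m} k \<inter> ?g ` disjoint_pairs m k = {}"
    by (auto simp: basis_pairs_def)
  ultimately show ?case
    using Suc.IH finite_basis_pairs[of "{1..m}" k] finite_disjoint_pairs[of m k]
    unfolding basis_pairs_Suc by (simp add: card_Un_disjoint)
qed

theorem theorem2:
  fixes n :: nat
  shows "(\<forall>i. ring.finite_dimension (Q_dual n :: 'f::field dual_tensor set ring)
              (Q_dual_scalars n) (Q_dual_component n i)) \<and>
    hilbert_series (Q_dual n :: 'f dual_tensor set ring) (Q_dual_scalars n) (Q_dual_component n)
      = (1 + fps_X * (2 + fps_X) ^ n) / (1 + fps_X)"
proof
  show "\<forall>i. ring.finite_dimension (Q_dual n :: 'f dual_tensor set ring) (Q_dual_scalars n) (Q_dual_component n i)"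
    using Q_dual_component_dimension(1) by blast
  let ?H = "hilbert_series (Q_dual n :: 'f dual_tensor set ring) (Q_dual_scalars n) (Q_dual_component n)"
  let ?S = "\<Sum>m<n. (2 + fps_X :: rat fps) ^ m"
  have S: "fps_nth ?S k = of_nat (card (basis_pairs {1..n} k))" for k
    unfolding card_basis_pairs by (simp add: fps_sum_nth disjoint_pairs_fps[symmetric])
  \<comment> \<open>The factor \<open>fps_X\<close> reflects that basis pairs with index
    \<open>k\<close> count degree \<open>k + 1\<close>; the summand \<open>1\<close> is degree
    0.\<close>
  have H: "?H = 1 + fps_X * ?S"
    unfolding hilbert_series_def Q_dual_component_dimension(2)
    by (intro fps_ext) (simp add: fps_X_mult_nth S del: fps_sum_nth split: nat.split)
  \<comment> \<open>A geometric sum with ratio \<open>2 + fps_X\<close>, whose difference from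
    \<open>1\<close> is the denominator \<open>1 + fps_X\<close>.\<close>
  have geometric: "(1 + fps_X) * ?S = (2 + fps_X) ^ n - 1"
    using power_diff_1_eq[of "2 + fps_X :: rat fps" n] by (simp add: algebra_simps)
  have "(1 + fps_X) * ?H = 1 + fps_X + fps_X * ((1 + fps_X) * ?S)"
    unfolding H by (simp only: distrib_left distrib_right mult_1_left mult_1_right mult_ac add_ac)
  also have "\<dots> = 1 + fps_X * (2 + fps_X) ^ n"
    unfolding geometric by (simp add: right_diff_distrib)
  finally have "(1 + fps_X) * ?H = 1 + fps_X * (2 + fps_X) ^ n" .
  moreover have "fps_nth (1 + fps_X :: rat fps) 0 \<noteq> fps_nth 0 0" by simp
  then have "1 + fps_X \<noteq> (0 :: rat fps)" by metis
  ultimately show "?H = (1 + fps_X * (2 + fps_X) ^ n) / (1 + fps_X)"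
    by (metis nonzero_mult_div_cancel_left)
qed

end
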